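(* Let $\mathbb{T}$ be a semi-abelian theory. There is a functor $\pi\colon\mathsf{Top}^{\mathbb{T}}\to\mathsf{Gpd}(\mathsf{Set}^{\mathbb{T}})$ assigning to each topological $\mathbb{T}$-algebra $A$ the internal groupoid $\pi A$ in $\mathsf{Set}^{\mathbb{T}}$ (the fundamental groupoid of $A$ with its induced operations).
   Context: An algebraic theory (in the sense of Lawvere) $\mathbb{T}$ is a category with objects $T^0,T,T^2,T^3,\dots$, where $T^n$ is the $n$-fold product of a distinguished object $T$ with itself, with chosen projections. Morphisms $T^n\to T$ are called $n$-ary operations; $0$-ary operations are called constants. A $\mathbb{T}$-algebra is a product-preserving functor $\mathbb{T}\to\mathsf{Set}$; equivalently, a set $A$ with a map $\tau=\tau_A\colon A^n\to A$ for each $n$-ary operation $\tau$, compatible with composition and projections in $\mathbb{T}$. A $\mathbb{T}$-homomorphism is a map commuting with all operations. The category of $\mathbb{T}$-algebras is $\mathsf{Set}^{\mathbb{T}}$. The theory $\mathbb{T}$ is called semi-abelian if $\mathsf{Set}^{\mathbb{T}}$ is a semi-abelian category (Barr-exact, protomodular, with finite coproducts and a zero object); equivalently (Bourn--Janelidze), $\mathbb{T}$ has a unique constant $e$ and, for some natural number $n$, has binary operations $\alpha_1,\dots,\alpha_n$ with $\alpha_i(X,X)=e$ and an $(n+1)$-ary operation $\theta$ with $\theta(\alpha_1(X,Y),\dots,\alpha_n(X,Y),Y)=X$. A topological $\mathbb{T}$-algebra is a topological space $A$ with a $\mathbb{T}$-algebra structure such that every operation $\tau_A\colon A^n\to A$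 is continuous; $\mathsf{Top}^{\mathbb{T}}$ is the category of topological $\mathbb{T}$-algebras and continuous $\mathbb{T}$-homomorphisms. The fundamental groupoid $\pi A$ has the points of $A$ as objects; its arrows from $x$ to $y$ are homotopy classes $[\beta]$ relative to end points of paths from $x$ to $y$, composed by concatenation. The objects carry the $\mathbb{T}$-algebra structure of $A$ and the arrows carry the operations $\tau([\beta_1],\dots,[\beta_n])=[\tau(\beta_1,\dots,\beta_n)]$, where $\tau(\beta_1,\dots,\beta_n)(t)=\tau(\beta_1(t),\dots,\beta_n(t))$. A continuous $\mathbb{T}$-homomorphism $f\colon A\to B$ induces $\pi f$, equal to $f$ on objects and $[\beta]\mapsto[f\beta]$ on arrows. An internal groupoid in $\mathsf{Set}^{\mathbb{T}}$ is a groupoid $G$ (the arrow set also denoted $G$) such that $\mathsf{Ob}(G)$ and $G$ are $\mathbb{T}$-algebras and the source and target maps, the identity map $\mathsf{Ob}(G)\to G$, the partial composition and the inversion are all $\mathbb{T}$-homomorphisms. $\mathsf{Gpd}(\mathsf{Set}^{\mathbb{T}})$ is the category of internal groupoids in $\mathsf{Set}^{\mathbb{T}}$, with morphisms the groupoid morphisms (functors) that are $\mathbb{T}$-homomorphisms on objects and on arrows. *)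

theory Defs
  imports "HOL-Analysis.Analysis"
begin

section \<open>Categories and functors\<close>

record ('o, 'm) category =
  Ob :: "'o set"
  Arr :: "'m set"
  Dom :: "'m \<Rightarrow> 'o"
  Cod :: "'m \<Rightarrow> 'o"
  Ide :: "'o \<Rightarrow> 'm"
  Comp :: "'m \<Rightarrow> 'm \<Rightarrow> 'm"  \<comment> \<open>\<open>Comp C g f\<close> is \<open>g\<close> after \<open>f\<close>\<close>

definition Hom :: "('o, 'm, 'z) category_scheme \<Rightarrow> 'o \<Rightarrow> 'o \<Rightarrow> 'm set" where
  "Hom C a b = {f \<in> Arr C. Dom C f = a \<and> Cod C f = b}"

definition is_category :: "('o, 'm, 'z) category_scheme \<Rightarrow> bool" where
  "is_category C \<longleftrightarrow>
     (\<forall>f\<in>Arr C. Dom C f \<in> Ob C \<and> Cod C f \<in> Ob C) \<and>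
     (\<forall>a\<in>Ob C. Ide C a \<in> Hom C a a) \<and>
     (\<forall>a b c. \<forall>f\<in>Hom C a b. \<forall>g\<in>Hom C b c. Comp C g f \<in> Hom C a c) \<and>
     (\<forall>a b. \<forall>f\<in>Hom C a b. Comp C f (Ide C a) = f \<and> Comp C (Ide C b) f = f) \<and>
     (\<forall>a b c d. \<forall>f\<in>Hom C a b. \<forall>g\<in>Hom C b c. \<forall>h\<in>Hom C c d.
        Comp C h (Comp C g f) = Comp C (Comp C h g) f)"

definition is_functor ::
  "('o, 'm, 'z) category_scheme \<Rightarrow> ('p, 'n, 'w) category_scheme \<Rightarrow>
   ('o \<Rightarrow> 'p) \<Rightarrow> ('m \<Rightarrow> 'n) \<Rightarrow> bool" where
  "is_functor C D F0 F1 \<longleftrightarrow>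
     is_category C \<and> is_category D \<and>
     (\<forall>a\<in>Ob C. F0 a \<in> Ob D) \<and>
     (\<forall>a b. \<forall>f\<in>Hom C a b. F1 f \<in> Hom D (F0 a) (F0 b)) \<and>
     (\<forall>a\<in>Ob C. F1 (Ide C a) = Ide D (F0 a)) \<and>
     (\<forall>a b c. \<forall>f\<in>Hom C a b. \<forall>g\<in>Hom C b c. F1 (Comp C g f) = Comp D (F1 g) (F1 f))"


section \<open>Semi-abelian categories\<close>

definition is_iso :: "('o, 'm, 'z) category_scheme \<Rightarrow> 'm \<Rightarrow> bool" where
  "is_iso C f \<longleftrightarrow> f \<in> Arr C \<and>
     (\<exists>g\<in>Hom C (Cod C f) (Dom C f).
        Comp C g f = Ide C (Dom C f) \<and> Comp C f g = Ide C (Cod C f))"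

definition is_terminal :: "('o, 'm, 'z) category_scheme \<Rightarrow> 'o \<Rightarrow> bool" where
  "is_terminal C t \<longleftrightarrow> t \<in> Ob C \<and> (\<forall>a\<in>Ob C. \<exists>!f. f \<in> Hom C a t)"

definition is_initial :: "('o, 'm, 'z) category_scheme \<Rightarrow> 'o \<Rightarrow> bool" where
  "is_initial C t \<longleftrightarrow> t \<in> Ob C \<and> (\<forall>a\<in>Ob C. \<exists>!f. f \<in> Hom C t a)"

definition has_zero_object :: "('o, 'm, 'z) category_scheme \<Rightarrow> bool" where
  "has_zero_object C \<longleftrightarrow> (\<exists>z. is_initial C z \<and> is_terminal C z)"

definition is_coproduct ::
  "('o, 'm, 'z) category_scheme \<Rightarrow> nat \<Rightarrow> (nat \<Rightarrow> 'o) \<Rightarrow> 'o \<Rightarrow> (nat \<Rightarrow> 'm) \<Rightarrow> bool" where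
  "is_coproduct C n a s i \<longleftrightarrow>
     s \<in> Ob C \<and> (\<forall>k<n. i k \<in> Hom C (a k) s) \<and>
     (\<forall>d\<in>Ob C. \<forall>f. (\<forall>k<n. f k \<in> Hom C (a k) d) \<longrightarrow>
        (\<exists>!h. h \<in> Hom C s d \<and> (\<forall>k<n. Comp C h (i k) = f k)))"

definition has_finite_coproducts :: "('o, 'm, 'z) category_scheme \<Rightarrow> bool" where
  "has_finite_coproducts C \<longleftrightarrow>
     (\<forall>n a. (\<forall>k<n. a k \<in> Ob C) \<longrightarrow> (\<exists>s i. is_coproduct C n a s i))"

text \<open>\<open>is_pullback C f g p q\<close>: the square \<open>f \<circ> p = g \<circ> q\<close> is a pullback.\<close>

definition is_pullback ::
  "('o, 'm, 'z) category_scheme \<Rightarrow> 'm \<Rightarrow> 'm \<Rightarrow> 'm \<Rightarrow> 'm \<Rightarrow> bool" where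
  "is_pullback C f g p q \<longleftrightarrow>
     f \<in> Arr C \<and> g \<in> Arr C \<and> Cod C f = Cod C g \<and>
     p \<in> Hom C (Dom C p) (Dom C f) \<and> q \<in> Hom C (Dom C p) (Dom C g) \<and>
     Comp C f p = Comp C g q \<and>
     (\<forall>x. \<forall>u\<in>Hom C x (Dom C f). \<forall>v\<in>Hom C x (Dom C g).
        Comp C f u = Comp C g v \<longrightarrow>
        (\<exists>!h. h \<in> Hom C x (Dom C p) \<and> Comp C p h = u \<and> Comp C q h = v))"

definition has_finite_limits :: "('o, 'm, 'z) category_scheme \<Rightarrow> bool" where
  "has_finite_limits C \<longleftrightarrow>
     (\<exists>t. is_terminal C t) \<and>
     (\<forall>f\<in>Arr C. \<forall>g\<in>Arr C. Cod C f = Cod C g \<longrightarrow> (\<exists>p q. is_pullback C f g p q))"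

definition is_coequalizer ::
  "('o, 'm, 'z) category_scheme \<Rightarrow> 'm \<Rightarrow> 'm \<Rightarrow> 'm \<Rightarrow> bool" where
  "is_coequalizer C u v q \<longleftrightarrow>
     u \<in> Arr C \<and> v \<in> Hom C (Dom C u) (Cod C u) \<and> q \<in> Hom C (Cod C u) (Cod C q) \<and>
     Comp C q u = Comp C q v \<and>
     (\<forall>d. \<forall>f\<in>Hom C (Cod C u) d. Comp C f u = Comp C f v \<longrightarrow>
        (\<exists>!h. h \<in> Hom C (Cod C q) d \<and> Comp C h q = f))"

definition is_regular_epi :: "('o, 'm, 'z) category_scheme \<Rightarrow> 'm \<Rightarrow> bool" where
  "is_regular_epi C q \<longleftrightarrow> (\<exists>u v. is_coequalizer C u v q)"

definition regular_category :: "('o, 'm, 'z) category_scheme \<Rightarrow> bool" where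
  "regular_category C \<longleftrightarrow>
     is_category C \<and> has_finite_limits C \<and>
     (\<forall>f u v. is_pullback C f f u v \<longrightarrow> (\<exists>q. is_coequalizer C u v q)) \<and>
     (\<forall>f g p q. is_pullback C f g p q \<and> is_regular_epi C f \<longrightarrow> is_regular_epi C q)"

definition is_internal_equivalence ::
  "('o, 'm, 'z) category_scheme \<Rightarrow> 'o \<Rightarrow> 'm \<Rightarrow> 'm \<Rightarrow> bool" where
  "is_internal_equivalence C a d0 d1 \<longleftrightarrow>
     d0 \<in> Hom C (Dom C d0) a \<and> d1 \<in> Hom C (Dom C d0) a \<and>
     \<comment> \<open>jointly monic\<close>
     (\<forall>x. \<forall>u\<in>Hom C x (Dom C d0). \<forall>v\<in>Hom C x (Dom C d0).
        Comp C d0 u = Comp C d0 v \<and> Comp C d1 u = Comp C d1 v \<longrightarrow> u = v) \<and>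
     \<comment> \<open>reflexive\<close>
     (\<exists>r\<in>Hom C a (Dom C d0). Comp C d0 r = Ide C a \<and> Comp C d1 r = Ide C a) \<and>
     \<comment> \<open>symmetric\<close>
     (\<exists>s\<in>Hom C (Dom C d0) (Dom C d0). Comp C d0 s = d1 \<and> Comp C d1 s = d0) \<and>
     \<comment> \<open>transitive\<close>
     (\<forall>p q. is_pullback C d1 d0 p q \<longrightarrow>
        (\<exists>t\<in>Hom C (Dom C p) (Dom C d0).
           Comp C d0 t = Comp C d0 p \<and> Comp C d1 t = Comp C d1 q))"

definition barr_exact :: "('o, 'm, 'z) category_scheme \<Rightarrow> bool" where
  "barr_exact C \<longleftrightarrow>
     regular_category C \<and>
     (\<forall>a\<in>Ob C. \<forall>d0 d1. is_internal_equivalence C a d0 d1 \<longrightarrow>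
        (\<exists>f. is_pullback C f f d0 d1))"

text \<open>
  A point over \<open>b\<close> is a split epimorphism into \<open>b\<close> with a chosen splitting.  A category with
  finite limits is protomodular (Bourn) if, for every \<open>p : e \<rightarrow> b\<close>, the change-of-base functor
  from points over \<open>b\<close> to points over \<open>e\<close> reflects isomorphisms.  Below, \<open>k\<close> is the image of the
  morphism of points \<open>h\<close> under change of base along \<open>p\<close>; it preserves the induced splittings
  automatically, and a morphism of points is invertible iff its underlying arrow is.
\<close>

definition is_point :: "('o, 'm, 'z) category_scheme \<Rightarrow> 'o \<Rightarrow> 'm \<Rightarrow> 'm \<Rightarrow> bool" where
  "is_point C b f s \<longleftrightarrow>
     f \<in> Hom C (Dom C f) b \<and> s \<in> Hom C b (Dom C f) \<and> Comp C f s = Ide C b"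

definition protomodular :: "('o, 'm, 'z) category_scheme \<Rightarrow> bool" where
  "protomodular C \<longleftrightarrow>
     is_category C \<and> has_finite_limits C \<and>
     (\<forall>p\<in>Arr C. \<forall>f s f' s' h x y x' y' k.
        is_point C (Cod C p) f s \<and> is_point C (Cod C p) f' s' \<and>
        h \<in> Hom C (Dom C f) (Dom C f') \<and> Comp C f' h = f \<and> Comp C h s = s' \<and>
        is_pullback C p f x y \<and> is_pullback C p f' x' y' \<and>
        k \<in> Hom C (Dom C x) (Dom C x') \<and> Comp C x' k = x \<and> Comp C y' k = Comp C h y \<and>
        is_iso C k \<longrightarrow> is_iso C h)"

definition semi_abelian_category :: "('o, 'm, 'z) category_scheme \<Rightarrow> bool" where
  "semi_abelian_category C \<longleftrightarrow>
     barr_exact C \<and> protomodular C \<and> has_finite_coproducts C \<and> has_zero_object C"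


section \<open>Algebraic theories and their algebras\<close>

text \<open>The object \<open>T\<^sup>n\<close> of an algebraic theory is represented by the natural number \<open>n\<close>.\<close>

record 'm lawvere = "(nat, 'm) category" +
  Proj :: "nat \<Rightarrow> nat \<Rightarrow> 'm"  \<comment> \<open>\<open>Proj T n i\<close> is the \<open>i\<close>-th projection, \<open>i < n\<close>\<close>

definition algebraic_theory :: "'m lawvere \<Rightarrow> bool" where
  "algebraic_theory T \<longleftrightarrow>
     is_category T \<and> Ob T = UNIV \<and>
     (\<forall>n. \<forall>i<n. Proj T n i \<in> Hom T n 1) \<and> Proj T 1 0 = Ide T 1 \<and>
     (\<forall>m n f. (\<forall>i<n. f i \<in> Hom T m 1) \<longrightarrow>
        (\<exists>!h. h \<in> Hom T m n \<and> (\<forall>i<n. Comp T (Proj T n i) h = f i)))"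

record ('m, 'a) alg =
  Carr :: "'a set"
  Op :: "'m \<Rightarrow> (nat \<Rightarrow> 'a) \<Rightarrow> 'a"

abbreviation tuples :: "nat \<Rightarrow> 'a set \<Rightarrow> (nat \<Rightarrow> 'a) set" where
  "tuples n A \<equiv> {..<n} \<rightarrow>\<^sub>E A"

definition is_alg :: "'m lawvere \<Rightarrow> ('m, 'a) alg \<Rightarrow> bool" where
  "is_alg T A \<longleftrightarrow>
     (\<forall>n. \<forall>\<tau>\<in>Hom T n 1. Op A \<tau> \<in> tuples n (Carr A) \<rightarrow> Carr A) \<and>
     (\<forall>n. \<forall>i<n. \<forall>x\<in>tuples n (Carr A). Op A (Proj T n i) x = x i) \<and>
     (\<forall>m n. \<forall>f\<in>Hom T m n. \<forall>\<tau>\<in>Hom T n 1. \<forall>x\<in>tuples m (Carr A).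
        Op A (Comp T \<tau> f) x = Op A \<tau> (\<lambda>i\<in>{..<n}. Op A (Comp T (Proj T n i) f) x))"

definition is_alg_hom ::
  "'m lawvere \<Rightarrow> ('m, 'a) alg \<Rightarrow> ('m, 'b) alg \<Rightarrow> ('a \<Rightarrow> 'b) \<Rightarrow> bool" where
  "is_alg_hom T A B f \<longleftrightarrow>
     f \<in> Carr A \<rightarrow> Carr B \<and>
     (\<forall>n. \<forall>\<tau>\<in>Hom T n 1. \<forall>x\<in>tuples n (Carr A).
        f (Op A \<tau> x) = Op B \<tau> (\<lambda>i\<in>{..<n}. f (x i)))"

text \<open>
  Morphisms of concrete categories carry their domain and codomain; the underlying maps are made
  extensional, so that morphisms are equal iff they agree on the carrier.  Objects are not
  normalised outside their carriers: objects that differ only there are isomorphic.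
\<close>

record ('x, 'f) mor =
  MDom :: 'x
  MCod :: 'x
  MMap :: 'f

text \<open>The category of algebras whose carriers are subsets of the type \<open>'a\<close>.\<close>

definition alg_cat :: "'m lawvere \<Rightarrow> (('m, 'a) alg, (('m, 'a) alg, 'a \<Rightarrow> 'a) mor) category" where
  "alg_cat T = \<lparr>
     Ob = {A. is_alg T A},
     Arr = {f. is_alg T (MDom f) \<and> is_alg T (MCod f) \<and>
               is_alg_hom T (MDom f) (MCod f) (MMap f) \<and>
               MMap f \<in> extensional (Carr (MDom f))},
     Dom = MDom,
     Cod = MCod,
     Ide = (\<lambda>A. \<lparr>MDom = A, MCod = A, MMap = (\<lambda>x\<in>Carr A. x)\<rparr>),
     Comp = (\<lambda>g f. \<lparr>MDom = MDom f, MCod = MCod g,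
                    MMap = compose (Carr (MDom f)) (MMap g) (MMap f)\<rparr>)\<rparr>"

text \<open>
  Semi-abelianness of the category of algebras needs a universe of sets to draw carriers from.
  The type \<open>'m + nat\<close> is infinite and at least as large as the set of operations, so the algebras
  carried by its subsets include, up to isomorphism, the free algebras on finite sets, and are
  closed under finite limits, quotients and finite coproducts.  Hence the property does not change
  if a larger universe is taken.
\<close>

definition semi_abelian_theory :: "'m lawvere \<Rightarrow> bool" where
  "semi_abelian_theory T \<longleftrightarrow>
     algebraic_theory T \<and>
     semi_abelian_category
       (alg_cat T :: (('m, 'm + nat) alg,
                      (('m, 'm + nat) alg, 'm + nat \<Rightarrow> 'm + nat) mor) category)"


section \<open>Topological algebras\<close>

record ('m, 'a) top_alg =
  Top :: "'a topology"
  TOp :: "'m \<Rightarrow> (nat \<Rightarrow> 'a) \<Rightarrow> 'a"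

definition alg_of :: "('m, 'a) top_alg \<Rightarrow> ('m, 'a) alg" where
  "alg_of A = \<lparr>Carr = topspace (Top A), Op = TOp A\<rparr>"

definition is_top_alg :: "'m lawvere \<Rightarrow> ('m, 'a) top_alg \<Rightarrow> bool" where
  "is_top_alg T A \<longleftrightarrow>
     is_alg T (alg_of A) \<and>
     (\<forall>n. \<forall>\<tau>\<in>Hom T n 1.
        continuous_map (product_topology (\<lambda>i. Top A) {..<n}) (Top A) (TOp A \<tau>))"

definition top_alg_cat ::
  "'m lawvere \<Rightarrow> (('m, 'a) top_alg, (('m, 'a) top_alg, 'a \<Rightarrow> 'a) mor) category" where
  "top_alg_cat T = \<lparr>
     Ob = {A. is_top_alg T A},
     Arr = {f. is_top_alg T (MDom f) \<and> is_top_alg T (MCod f) \<and>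
               continuous_map (Top (MDom f)) (Top (MCod f)) (MMap f) \<and>
               is_alg_hom T (alg_of (MDom f)) (alg_of (MCod f)) (MMap f) \<and>
               MMap f \<in> extensional (topspace (Top (MDom f)))},
     Dom = MDom,
     Cod = MCod,
     Ide = (\<lambda>A. \<lparr>MDom = A, MCod = A, MMap = (\<lambda>x\<in>topspace (Top A). x)\<rparr>),
     Comp = (\<lambda>g f. \<lparr>MDom = MDom f, MCod = MCod g,
                    MMap = compose (topspace (Top (MDom f))) (MMap g) (MMap f)\<rparr>)\<rparr>"


section \<open>Internal groupoids in the category of algebras\<close>

record ('o, 'r) groupoid = "('o, 'r) category" +
  Inv :: "'r \<Rightarrow> 'r"

definition is_groupoid :: "('o, 'r, 'z) groupoid_scheme \<Rightarrow> bool" where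
  "is_groupoid G \<longleftrightarrow>
     is_category G \<and>
     (\<forall>a b. \<forall>f\<in>Hom G a b. Inv G f \<in> Hom G b a \<and>
        Comp G (Inv G f) f = Ide G a \<and> Comp G f (Inv G f) = Ide G b)"

record ('o, 'r, 'm) int_groupoid = "('o, 'r) groupoid" +
  ObOp :: "'m \<Rightarrow> (nat \<Rightarrow> 'o) \<Rightarrow> 'o"
  ArrOp :: "'m \<Rightarrow> (nat \<Rightarrow> 'r) \<Rightarrow> 'r"

definition ob_alg :: "('o, 'r, 'm) int_groupoid \<Rightarrow> ('m, 'o) alg" where
  "ob_alg G = \<lparr>Carr = Ob G, Op = ObOp G\<rparr>"

definition arr_alg :: "('o, 'r, 'm) int_groupoid \<Rightarrow> ('m, 'r) alg" where
  "arr_alg G = \<lparr>Carr = Arr G, Op = ArrOp G\<rparr>"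

text \<open>The algebra of composable pairs, a subalgebra of the square of the algebra of arrows.\<close>

definition pair_alg :: "'m lawvere \<Rightarrow> ('o, 'r, 'm) int_groupoid \<Rightarrow> ('m, 'r \<times> 'r) alg" where
  "pair_alg T G = \<lparr>
     Carr = {(g, f). g \<in> Arr G \<and> f \<in> Arr G \<and> Dom G g = Cod G f},
     Op = (\<lambda>\<tau> z. (ArrOp G \<tau> (\<lambda>i\<in>{..<Dom T \<tau>}. fst (z i)),
                   ArrOp G \<tau> (\<lambda>i\<in>{..<Dom T \<tau>}. snd (z i))))\<rparr>"

definition is_int_groupoid :: "'m lawvere \<Rightarrow> ('o, 'r, 'm) int_groupoid \<Rightarrow> bool" where
  "is_int_groupoid T G \<longleftrightarrow>
     is_groupoid G \<and> is_alg T (ob_alg G) \<and> is_alg T (arr_alg G) \<and>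
     is_alg_hom T (arr_alg G) (ob_alg G) (Dom G) \<and>
     is_alg_hom T (arr_alg G) (ob_alg G) (Cod G) \<and>
     is_alg_hom T (ob_alg G) (arr_alg G) (Ide G) \<and>
     is_alg_hom T (pair_alg T G) (arr_alg G) (\<lambda>(g, f). Comp G g f) \<and>
     is_alg_hom T (arr_alg G) (arr_alg G) (Inv G)"

definition int_groupoid_cat ::
  "'m lawvere \<Rightarrow>
   (('o, 'r, 'm) int_groupoid,
    (('o, 'r, 'm) int_groupoid, ('o \<Rightarrow> 'o) \<times> ('r \<Rightarrow> 'r)) mor) category" where
  "int_groupoid_cat T = \<lparr>
     Ob = {G. is_int_groupoid T G},
     Arr = {F. is_int_groupoid T (MDom F) \<and> is_int_groupoid T (MCod F) \<and>
               is_functor (MDom F) (MCod F) (fst (MMap F)) (snd (MMap F)) \<and>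
               is_alg_hom T (ob_alg (MDom F)) (ob_alg (MCod F)) (fst (MMap F)) \<and>
               is_alg_hom T (arr_alg (MDom F)) (arr_alg (MCod F)) (snd (MMap F)) \<and>
               fst (MMap F) \<in> extensional (Ob (MDom F)) \<and>
               snd (MMap F) \<in> extensional (Arr (MDom F))},
     Dom = MDom,
     Cod = MCod,
     Ide = (\<lambda>G. \<lparr>MDom = G, MCod = G, MMap = (\<lambda>x\<in>Ob G. x, \<lambda>c\<in>Arr G. c)\<rparr>),
     Comp = (\<lambda>K F. \<lparr>MDom = MDom F, MCod = MCod K,
                    MMap = (compose (Ob (MDom F)) (fst (MMap K)) (fst (MMap F)),
                            compose (Arr (MDom F)) (snd (MMap K)) (snd (MMap F)))\<rparr>)\<rparr>"


section \<open>The fundamental groupoid\<close>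

text \<open>The homotopy class relative to end points of a path; its members determine those end points.\<close>

definition path_class :: "'a topology \<Rightarrow> (real \<Rightarrow> 'a) \<Rightarrow> (real \<Rightarrow> 'a) set" where
  "path_class X p =
     {q. homotopic_with (\<lambda>h. h 0 = p 0 \<and> h 1 = p 1) (top_of_set {0..1}) X p q}"

text \<open>The library's \<open>joinpaths\<close> is only available over the class \<open>topological_space\<close>.\<close>

definition concat_path :: "(real \<Rightarrow> 'a) \<Rightarrow> (real \<Rightarrow> 'a) \<Rightarrow> real \<Rightarrow> 'a" where
  "concat_path p q = (\<lambda>t. if t \<le> 1/2 then p (2 * t) else q (2 * t - 1))"

text \<open>
  The structure on classes is given without choosing representatives, as the union of the classes
  obtained from all representatives.  Such a union is an arrow of the groupoid only if all those
  classes coincide, so well-definedness is part of the claim that this is an internal groupoid.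
  \<open>Comp\<close> takes the later path first, so \<open>Comp d c\<close> is the class of a path in \<open>c\<close> followed by a
  path in \<open>d\<close>.
\<close>

definition fundamental_groupoid ::
  "'m lawvere \<Rightarrow> ('m, 'a) top_alg \<Rightarrow> ('a, (real \<Rightarrow> 'a) set, 'm) int_groupoid" where
  "fundamental_groupoid T A = \<lparr>
     Ob = topspace (Top A),
     Arr = {path_class (Top A) p |p. pathin (Top A) p},
     Dom = (\<lambda>c. the_elem ((\<lambda>p. p 0) ` c)),
     Cod = (\<lambda>c. the_elem ((\<lambda>p. p 1) ` c)),
     Ide = (\<lambda>x. path_class (Top A) (\<lambda>t. x)),
     Comp = (\<lambda>d c. \<Union>p\<in>c. \<Union>q\<in>d. path_class (Top A) (concat_path p q)),
     Inv = (\<lambda>c. \<Union>p\<in>c. path_class (Top A) (\<lambda>t. p (1 - t))),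
     ObOp = TOp A,
     ArrOp = (\<lambda>\<tau> c. \<Union>\<beta> \<in> (\<Pi>\<^sub>E i\<in>{..<Dom T \<tau>}. c i).
                path_class (Top A) (\<lambda>t. TOp A \<tau> (\<lambda>i\<in>{..<Dom T \<tau>}. \<beta> i t)))\<rparr>"

definition fundamental_groupoid_map ::
  "'m lawvere \<Rightarrow> (('m, 'a) top_alg, 'a \<Rightarrow> 'a) mor \<Rightarrow>
   (('a, (real \<Rightarrow> 'a) set, 'm) int_groupoid,
    ('a \<Rightarrow> 'a) \<times> ((real \<Rightarrow> 'a) set \<Rightarrow> (real \<Rightarrow> 'a) set)) mor" where
  "fundamental_groupoid_map T f = \<lparr>
     MDom = fundamental_groupoid T (MDom f),
     MCod = fundamental_groupoid T (MCod f),
     MMap = (MMap f,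
             \<lambda>c\<in>Arr (fundamental_groupoid T (MDom f)).
               \<Union>p\<in>c. path_class (Top (MCod f)) (MMap f \<circ> p))\<rparr>"

end

theory Submission
  imports Defs
begin

text \<open>
  Continuity of the operations makes them act on paths and on homotopies pointwise.  Acting on
  homotopies, they respect homotopy relative to end points, so the arrows of the fundamental
  groupoid inherit operations (\<open>op_path_class\<close>, \<open>fg_ArrOp\<close>); every equation of the theory holds
  for these because it already holds pointwise for representing paths (\<open>arr_alg_is_alg\<close>).  The
  source, target, identity, composition and inversion maps are homomorphisms for the same reason:
  evaluation at a parameter, constant paths, reversal, and concatenation all commute with a
  pointwise operation on the nose, before passing to classes
  (\<open>fundamental_groupoid_is_int_groupoid\<close>).

  The groupoid laws come from one fact: two reparametrisations of a path that agree at the end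
  points give homotopic paths, because the unit interval is convex (\<open>path_class_reparam\<close>).  Each of
  the unit, inverse and associativity laws compares two reparametrisations of a single path.

  A continuous homomorphism acts on paths by composition, which respects homotopies and commutes
  with concatenation and with pointwise operations, so it induces a morphism of internal groupoids
  (\<open>fundamental_groupoid_map_Hom\<close>).  Functoriality is then checked on representing paths.

  The structure on classes is a union over all representatives.  Since every member of such a union
  is the same class, it can be evaluated on a single representative; this is what \<open>fg_Comp\<close>,
  \<open>fg_Inv\<close>, \<open>fg_ArrOp\<close> and \<open>fundamental_groupoid_map_class\<close> do, and everything else works with
  representing paths only.
\<close>

section \<open>Categories, functors and algebras\<close>

lemma HomD: "f \<in> Hom C a b \<Longrightarrow> Dom C f = a" "f \<in> Hom C a b \<Longrightarrow> Cod C f = b"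
  by (auto simp: Hom_def)

lemma category_Comp:
  assumes "is_category C" "f \<in> Hom C a b" "g \<in> Hom C b c"
  shows "Comp C g f \<in> Hom C a c"
proof -
  have "\<forall>a b c. \<forall>f\<in>Hom C a b. \<forall>g\<in>Hom C b c. Comp C g f \<in> Hom C a c"
    using assms(1) unfolding is_category_def by (elim conjE)
  with assms(2,3) show ?thesis by blast
qed

lemma category_Ide: "is_category C \<Longrightarrow> a \<in> Ob C \<Longrightarrow> Ide C a \<in> Hom C a a"
  unfolding is_category_def by blast

lemma theory_Comp:
  assumes "algebraic_theory T" "f \<in> Hom T m n" "g \<in> Hom T n k"
  shows "Comp T g f \<in> Hom T m k"
  using category_Comp[OF _ assms(2,3)] assms(1) by (simp add: algebraic_theory_def)

lemma theory_Proj: "algebraic_theory T \<Longrightarrow> i < n \<Longrightarrow> Proj T n i \<in> Hom T n 1"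
  unfolding algebraic_theory_def by blast

lemma is_functor_Id:
  assumes "is_category C" shows "is_functor C C (\<lambda>x\<in>Ob C. x) (\<lambda>c\<in>Arr C. c)"
proof -
  have "a \<in> Ob C" "b \<in> Ob C" "f \<in> Arr C" if "f \<in> Hom C a b" for f a b
    using assms that by (auto simp: is_category_def Hom_def)
  moreover have "Ide C a \<in> Arr C" if "a \<in> Ob C" for a
    using assms that by (auto simp: is_category_def Hom_def)
  ultimately show ?thesis
    using assms category_Comp[OF assms] unfolding is_functor_def by (simp, blast)
qed

lemma is_functor_compose:
  assumes F: "is_functor C D F0 F1" and K: "is_functor D E K0 K1"
  shows "is_functor C E (compose (Ob C) K0 F0) (compose (Arr C) K1 F1)"
proof -
  have C: "is_category C" and E: "is_category E"
    using F K by (auto simp: is_functor_def)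
  have ob: "a \<in> Ob C" "b \<in> Ob C" "f \<in> Arr C" if "f \<in> Hom C a b" for f a b
    using C that by (auto simp: is_category_def Hom_def)
  have ide: "Ide C a \<in> Hom C a a" if "a \<in> Ob C" for a
    using C that by (auto simp: is_category_def)
  have F0: "F0 a \<in> Ob D" "F1 (Ide C a) = Ide D (F0 a)" if "a \<in> Ob C" for a
    using F that unfolding is_functor_def by blast+
  have K0: "K0 a \<in> Ob E" "K1 (Ide D a) = Ide E (K0 a)" if "a \<in> Ob D" for a
    using K that unfolding is_functor_def by blast+
  have F1: "F1 f \<in> Hom D (F0 a) (F0 b)" if "f \<in> Hom C a b" for f a b
    using F that unfolding is_functor_def by blast
  have K1: "K1 f \<in> Hom E (K0 a) (K0 b)" if "f \<in> Hom D a b" for f a b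
    using K that unfolding is_functor_def by blast
  have F2: "F1 (Comp C g f) = Comp D (F1 g) (F1 f)" if "f \<in> Hom C a b" "g \<in> Hom C b c" for f g a b c
    using F that unfolding is_functor_def by blast
  have K2: "K1 (Comp D g f) = Comp E (K1 g) (K1 f)" if "f \<in> Hom D a b" "g \<in> Hom D b c" for f g a b c
    using K that unfolding is_functor_def by blast
  show ?thesis
    unfolding is_functor_def
  proof (intro conjI allI ballI C E)
    show "compose (Ob C) K0 F0 a \<in> Ob E" if "a \<in> Ob C" for a
      using that F0 K0 by (simp add: compose_eq)
    show "compose (Arr C) K1 F1 f \<in> Hom E (compose (Ob C) K0 F0 a) (compose (Ob C) K0 F0 b)"
      if "f \<in> Hom C a b" for f a b
      using ob[OF that] K1[OF F1[OF that]] by (simp add: compose_eq)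
    show "compose (Arr C) K1 F1 (Ide C a) = Ide E (compose (Ob C) K0 F0 a)" if "a \<in> Ob C" for a
      using that ob(3)[OF ide[OF that]] F0 K0 by (simp add: compose_eq)
    show "compose (Arr C) K1 F1 (Comp C g f) =
        Comp E (compose (Arr C) K1 F1 g) (compose (Arr C) K1 F1 f)"
      if "f \<in> Hom C a b" "g \<in> Hom C b c" for f g a b c
      using ob(3)[OF that(1)] ob(3)[OF that(2)] ob(3)[OF category_Comp[OF C that]]
        F2[OF that] K2[OF F1[OF that(1)] F1[OF that(2)]] by (simp add: compose_eq)
  qed
qed

lemma alg_op_closed:
  assumes "is_alg T A" "\<tau> \<in> Hom T n 1" "x \<in> tuples n (Carr A)"
  shows "Op A \<tau> x \<in> Carr A"
proof -
  have "\<forall>n. \<forall>\<tau>\<in>Hom T n 1. Op A \<tau> \<in> tuples n (Carr A) \<rightarrow> Carr A"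
    using assms(1) unfolding is_alg_def by (elim conjE)
  with assms(2,3) show ?thesis by blast
qed

lemma alg_compD:
  assumes "is_alg T A" "f \<in> Hom T m n" "\<tau> \<in> Hom T n 1" "x \<in> tuples m (Carr A)"
  shows "Op A (Comp T \<tau> f) x = Op A \<tau> (\<lambda>i\<in>{..<n}. Op A (Comp T (Proj T n i) f) x)"
  using assms unfolding is_alg_def by blast

lemma is_alg_hom_Id:
  assumes "is_alg T A" shows "is_alg_hom T A A (\<lambda>x\<in>Carr A. x)"
  unfolding is_alg_hom_def
proof (intro conjI allI ballI)
  fix n \<tau> x assume \<tau>: "\<tau> \<in> Hom T n 1" and x: "x \<in> tuples n (Carr A)"
  have "(\<lambda>i\<in>{..<n}. (\<lambda>x\<in>Carr A. x) (x i)) = x"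
    using x by (auto simp: fun_eq_iff PiE_iff extensional_def)
  then show "(\<lambda>x\<in>Carr A. x) (Op A \<tau> x) = Op A \<tau> (\<lambda>i\<in>{..<n}. (\<lambda>x\<in>Carr A. x) (x i))"
    using alg_op_closed[OF assms \<tau> x] by simp
qed simp

lemma is_alg_hom_compose:
  assumes A: "is_alg T A" and f: "is_alg_hom T A B f" and g: "is_alg_hom T B C g"
  shows "is_alg_hom T A C (compose (Carr A) g f)"
  unfolding is_alg_hom_def
proof (intro conjI allI ballI)
  have fB: "f \<in> Carr A \<rightarrow> Carr B" and gC: "g \<in> Carr B \<rightarrow> Carr C"
    using f g by (auto simp: is_alg_hom_def)
  then show "compose (Carr A) g f \<in> Carr A \<rightarrow> Carr C" by (rule funcset_compose)
  fix n \<tau> x assume \<tau>: "\<tau> \<in> Hom T n 1" and x: "x \<in> tuples n (Carr A)"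
  have fx: "(\<lambda>i\<in>{..<n}. f (x i)) \<in> tuples n (Carr B)" using fB x by (auto simp: PiE_iff)
  have "compose (Carr A) g f (Op A \<tau> x) = g (f (Op A \<tau> x))"
    using alg_op_closed[OF A \<tau> x] by (simp add: compose_eq)
  also have "\<dots> = g (Op B \<tau> (\<lambda>i\<in>{..<n}. f (x i)))"
    using f \<tau> x by (simp add: is_alg_hom_def)
  also have "\<dots> = Op C \<tau> (\<lambda>i\<in>{..<n}. g ((\<lambda>i\<in>{..<n}. f (x i)) i))"
    using g \<tau> fx unfolding is_alg_hom_def by blast
  also have "(\<lambda>i\<in>{..<n}. g ((\<lambda>i\<in>{..<n}. f (x i)) i)) = (\<lambda>i\<in>{..<n}. compose (Carr A) g f (x i))"
    using x by (intro restrict_ext) (auto simp: compose_eq PiE_iff)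
  finally show "compose (Carr A) g f (Op A \<tau> x) =
      Op C \<tau> (\<lambda>i\<in>{..<n}. compose (Carr A) g f (x i))" .
qed

section \<open>Homotopy classes of paths\<close>

abbreviation unit_square :: "(real \<times> real) topology" where
  "unit_square \<equiv> prod_topology (top_of_set {0..1}) (top_of_set {0..1})"

text \<open>
  The library's homotopies satisfy their boundary conditions on the whole type of reals, although
  continuity is only required on the unit interval.  As the end point condition only looks at the
  parameters 0 and 1, everything can be restricted to the unit square, where homotopies are
  easy to build.
\<close>

lemma mem_path_class_iff:
  "q \<in> path_class X p \<longleftrightarrow>
     (\<exists>H. continuous_map unit_square X H \<and>
        (\<forall>t\<in>{0..1}. H (0, t) = p t \<and> H (1, t) = q t) \<and>
        (\<forall>s\<in>{0..1}. H (s, 0) = p 0 \<and> H (s, 1) = p 1))"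
proof -
  have "q \<in> path_class X p \<longleftrightarrow>
     (\<exists>H. continuous_map unit_square X H \<and>
        (\<forall>t\<in>topspace (top_of_set {0..1}). H (0, t) = p t) \<and>
        (\<forall>t\<in>topspace (top_of_set {0..1}). H (1, t) = q t) \<and>
        (\<forall>s\<in>{0..1}. H (s, 0) = p 0 \<and> H (s, 1) = p 1))"
    unfolding path_class_def mem_Collect_eq by (subst homotopic_with) (simp, rule refl)
  then show ?thesis by (simp add: ball_conj_distrib conj_assoc)
qed

lemma mem_path_classI:
  assumes "continuous_map unit_square X H"
    and "\<And>t. t \<in> {0..1} \<Longrightarrow> H (0, t) = p t" "\<And>t. t \<in> {0..1} \<Longrightarrow> H (1, t) = q t"
    and "\<And>s. s \<in> {0..1} \<Longrightarrow> H (s, 0) = p 0" "\<And>s. s \<in> {0..1} \<Longrightarrow> H (s, 1) = p 1"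
  shows "q \<in> path_class X p"
  unfolding mem_path_class_iff using assms by blast

lemma path_class_ends:
  assumes "q \<in> path_class X p" shows "q 0 = p 0" "q 1 = p 1"
  using assms unfolding path_class_def by (auto dest: homotopic_with_imp_property)

lemma path_class_refl: "pathin X p \<Longrightarrow> p \<in> path_class X p"
  unfolding path_class_def pathin_def by simp

lemma path_class_eqI:
  assumes "q \<in> path_class X p" shows "path_class X q = path_class X p"
proof -
  let ?h = "homotopic_with (\<lambda>h. h 0 = p 0 \<and> h 1 = p 1) (top_of_set {0..1}) X"
  have pq: "?h p q" using assms unfolding path_class_def by simp
  then have qp: "?h q p" by (simp only: homotopic_with_sym)
  have "?h q r \<longleftrightarrow> ?h p r" for r
    using homotopic_with_trans[OF pq] homotopic_with_trans[OF qp] by blast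
  then show ?thesis unfolding path_class_def path_class_ends[OF assms] by blast
qed

text \<open>
  A path is a function on all reals, but only its values on the unit interval matter.  This
  is what lets equations between operations, valid on the carrier only, pass to classes.
\<close>

lemma path_class_cong:
  assumes "pathin X p" "\<And>t. t \<in> {0..1} \<Longrightarrow> q t = p t"
  shows "path_class X q = path_class X p"
proof (rule path_class_eqI, rule mem_path_classI)
  show "continuous_map unit_square X (p \<circ> snd)"
    by (rule continuous_map_compose[OF continuous_map_snd]) (rule assms(1)[unfolded pathin_def])
  show "(p \<circ> snd) (1, t) = q t" if "t \<in> {0..1}" for t
    using assms(2)[OF that] by simp
qed auto

text \<open>
  The principle by which a structure map given as a union over all representatives is evaluated on
  a single one.
\<close>

lemma UN_path_class:
  assumes "pathin X p" "\<And>q. q \<in> path_class X p \<Longrightarrow> F q \<in> path_class Y (F p)"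
  shows "(\<Union>q\<in>path_class X p. path_class Y (F q)) = path_class Y (F p)"
proof -
  have "(\<lambda>q. path_class Y (F q)) ` path_class X p = {path_class Y (F p)}"
    using path_class_refl[OF assms(1)] path_class_eqI[OF assms(2)] by blast
  then show ?thesis by simp
qed

text \<open>
  The straight-line homotopy between the two parameter changes stays in the unit interval by
  convexity.
\<close>

lemma path_class_reparam:
  assumes p: "pathin X p"
    and \<phi>: "continuous_on {0..1} \<phi>" "\<phi> ` {0..1} \<subseteq> {0..1}"
    and \<psi>: "continuous_on {0..1} \<psi>" "\<psi> ` {0..1} \<subseteq> {0..1}"
    and ends: "\<phi> 0 = \<psi> 0" "\<phi> 1 = \<psi> 1"
  shows "path_class X (\<lambda>t. p (\<phi> t)) = path_class X (\<lambda>t. p (\<psi> t))"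
proof (rule path_class_eqI, rule mem_path_classI)
  let ?h = "\<lambda>(s, t). (1 - s) * \<psi> t + s * \<phi> t"
  have "continuous_on ({0..1} \<times> {0..1}) (\<lambda>z. \<phi> (snd z))"
    "continuous_on ({0..1} \<times> {0..1}) (\<lambda>z. \<psi> (snd z))"
    by (rule continuous_on_compose2[OF \<phi>(1)] continuous_on_compose2[OF \<psi>(1)];
        auto intro!: continuous_intros)+
  then have "continuous_on ({0..1} \<times> {0..1}) ?h"
    unfolding case_prod_unfold by (intro continuous_intros)
  moreover have "?h (s, t) \<in> {0..1}" if "s \<in> {0..1}" "t \<in> {0..1}" for s t
  proof -
    have "\<psi> t \<in> {0..1}" "\<phi> t \<in> {0..1}" using that \<phi>(2) \<psi>(2) by blast+
    then have "(1 - s) *\<^sub>R \<psi> t + s *\<^sub>R \<phi> t \<in> {0..1}"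
      using that convex_real_interval(5)[of "0::real" 1] by (intro convexD) auto
    then show ?thesis by simp
  qed
  ultimately have "continuous_map unit_square
      (top_of_set {0..1}) ?h"
    unfolding prod_topology_subtopology_eu by auto
  then show "continuous_map unit_square X (p \<circ> ?h)"
    using p unfolding pathin_def by (rule continuous_map_compose)
qed (auto simp: ends algebra_simps)

section \<open>Concatenation and reversal up to homotopy\<close>

lemma pathin_const_iff: "pathin X (\<lambda>t. x) \<longleftrightarrow> x \<in> topspace X"
  by (auto simp: pathin_def continuous_map_def)

lemma pathin_ends: assumes "pathin X p" shows "p 0 \<in> topspace X" "p 1 \<in> topspace X"
  using assms unfolding pathin_def continuous_map_def by auto

text \<open>
  With a one-point space for \<open>Z\<close> this says that a concatenation is a path, with the unit interval
  for \<open>Z\<close> that homotopies can be concatenated.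
\<close>

lemma continuous_map_concat:
  assumes F: "continuous_map (prod_topology Z (top_of_set {0..1})) X F"
    and G: "continuous_map (prod_topology Z (top_of_set {0..1})) X G"
    and FG: "\<And>s. s \<in> topspace Z \<Longrightarrow> F (s, 1) = G (s, 0)"
  shows "continuous_map (prod_topology Z (top_of_set {0..1})) X
           (\<lambda>(s, t). concat_path (\<lambda>t. F (s, t)) (\<lambda>t. G (s, t)) t)"
proof -
  let ?P = "prod_topology Z (top_of_set {0..1::real})"
  have snd: "continuous_map (subtopology ?P S) euclideanreal snd" for S
    using continuous_map_snd[of Z "top_of_set {0..1::real}"]
    by (auto intro: continuous_map_from_subtopology simp: continuous_map_in_subtopology)
  have fst: "continuous_map (subtopology ?P S) Z fst" for S
    by (intro continuous_map_from_subtopology continuous_map_fst)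
  have "continuous_map ?P X
     (\<lambda>z. if snd z \<le> 1/2 then F (fst z, 2 * snd z) else G (fst z, 2 * snd z - 1))"
  proof (rule continuous_map_cases_le)
    show "continuous_map (subtopology ?P {z \<in> topspace ?P. snd z \<le> 1/2}) X
        (\<lambda>z. F (fst z, 2 * snd z))"
      by (rule continuous_map_compose[OF _ F, unfolded o_def])
         (use fst snd in \<open>auto intro!: continuous_intros simp: continuous_map_pairwise o_def
             continuous_map_in_subtopology Pi_iff\<close>)
    show "continuous_map (subtopology ?P {z \<in> topspace ?P. 1/2 \<le> snd z}) X
        (\<lambda>z. G (fst z, 2 * snd z - 1))"
      by (rule continuous_map_compose[OF _ G, unfolded o_def])
         (use fst snd in \<open>auto intro!: continuous_intros simp: continuous_map_pairwise o_def
             continuous_map_in_subtopology Pi_iff\<close>)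
    show "continuous_map ?P euclideanreal snd"
      using snd[of UNIV] by simp
    fix z assume z: "z \<in> topspace ?P" "snd z = 1/2"
    then have "2 * snd z = 1" "2 * snd z - 1 = 0" by auto
    moreover have "fst z \<in> topspace Z" using z by auto
    ultimately show "F (fst z, 2 * snd z) = G (fst z, 2 * snd z - 1)" using FG by simp
  qed simp
  then show ?thesis by (simp add: concat_path_def case_prod_unfold)
qed

lemma concat_path_ends [simp]: "concat_path p q 0 = p 0" "concat_path p q 1 = q 1"
  by (auto simp: concat_path_def)

lemma pathin_concat:
  assumes "pathin X p" "pathin X q" "p 1 = q 0"
  shows "pathin X (concat_path p q)"
proof -
  \<comment> \<open>a path is a family of paths over a one-point space\<close>
  let ?P = "prod_topology (top_of_set {0::real}) (top_of_set {0..1::real})"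
  have "continuous_map ?P X (\<lambda>(s, t). concat_path (\<lambda>t. (p \<circ> snd) (s, t)) (\<lambda>t. (q \<circ> snd) (s, t)) t)"
  proof (rule continuous_map_concat)
    show "continuous_map ?P X (p \<circ> snd)" "continuous_map ?P X (q \<circ> snd)"
      using assms unfolding pathin_def
      by (simp_all only: continuous_map_compose[OF continuous_map_snd])
  qed (simp add: assms)
  moreover have "continuous_map (top_of_set {0..1}) ?P (\<lambda>t. (0, t))"
    by (auto intro!: continuous_intros)
  ultimately have "continuous_map (top_of_set {0..1}) X
     ((\<lambda>(s, t). concat_path (\<lambda>t. (p \<circ> snd) (s, t)) (\<lambda>t. (q \<circ> snd) (s, t)) t) \<circ> (\<lambda>t. (0::real, t)))"
    by (rule continuous_map_compose[rotated])
  then show ?thesis by (simp add: pathin_def o_def concat_path_def)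
qed

lemma pathin_reverse: "pathin X p \<Longrightarrow> pathin X (\<lambda>t. p (1 - t))"
  unfolding pathin_def
  by (rule continuous_map_compose[of _ "top_of_set {0..1}" "\<lambda>t. 1 - t", unfolded o_def])
     (auto intro!: continuous_intros)

lemma concat_path_class:
  assumes p: "p' \<in> path_class X p" and q: "q' \<in> path_class X q" and pq: "p 1 = q 0"
  shows "concat_path p' q' \<in> path_class X (concat_path p q)"
proof -
  obtain F where F: "continuous_map unit_square X F"
    "\<forall>t\<in>{0..1}. F (0, t) = p t \<and> F (1, t) = p' t" "\<forall>s\<in>{0..1}. F (s, 0) = p 0 \<and> F (s, 1) = p 1"
    using p unfolding mem_path_class_iff by blast
  obtain G where G: "continuous_map unit_square X G"
    "\<forall>t\<in>{0..1}. G (0, t) = q t \<and> G (1, t) = q' t" "\<forall>s\<in>{0..1}. G (s, 0) = q 0 \<and> G (s, 1) = q 1"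
    using q unfolding mem_path_class_iff by blast
  show ?thesis
  proof (rule mem_path_classI)
    show "continuous_map unit_square X
       (\<lambda>(s, t). concat_path (\<lambda>t. F (s, t)) (\<lambda>t. G (s, t)) t)"
      by (rule continuous_map_concat) (use F G pq in auto)
  qed (use F G in \<open>auto simp: concat_path_def\<close>)
qed

lemma reverse_path_class:
  assumes "p' \<in> path_class X p"
  shows "(\<lambda>t. p' (1 - t)) \<in> path_class X (\<lambda>t. p (1 - t))"
proof -
  obtain F where F: "continuous_map unit_square X F"
    "\<forall>t\<in>{0..1}. F (0, t) = p t \<and> F (1, t) = p' t" "\<forall>s\<in>{0..1}. F (s, 0) = p 0 \<and> F (s, 1) = p 1"
    using assms unfolding mem_path_class_iff by blast
  show ?thesis
  proof (rule mem_path_classI)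
    show "continuous_map unit_square X
       (F \<circ> (\<lambda>(s, t). (s, 1 - t)))"
      by (rule continuous_map_compose[OF _ F(1)])
         (auto simp: prod_topology_subtopology_eu case_prod_unfold intro!: continuous_intros)
  qed (use F in auto)
qed

lemma concat_const_left:
  assumes "pathin X p" shows "path_class X (concat_path (\<lambda>t. p 0) p) = path_class X p"
proof -
  have *: "continuous_on {0..1} (\<lambda>t::real. max 0 (2 * t - 1))" "(\<lambda>t. max 0 (2 * t - 1)) ` {0..1} \<subseteq> {0..1::real}"
    by (auto intro!: continuous_intros simp: min_le_iff_disj)
  have "max 0 (2 * t - 1) = (if t \<le> 1/2 then 0 else 2 * t - 1)" for t :: real by auto
  then have "concat_path (\<lambda>t. p 0) p = (\<lambda>t. p (max 0 (2 * t - 1)))"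
    by (simp add: concat_path_def fun_eq_iff)
  then show ?thesis
    using path_class_reparam[OF assms, of "\<lambda>t. max 0 (2 * t - 1)" "\<lambda>t. t"] *
    by (simp add: continuous_intros)
qed

lemma concat_const_right:
  assumes "pathin X p" shows "path_class X (concat_path p (\<lambda>t. p 1)) = path_class X p"
proof -
  have *: "continuous_on {0..1} (\<lambda>t::real. min 1 (2 * t))" "(\<lambda>t. min 1 (2 * t)) ` {0..1} \<subseteq> {0..1::real}"
    by (auto intro!: continuous_intros simp: min_le_iff_disj)
  have "min 1 (2 * t) = (if t \<le> 1/2 then 2 * t else 1)" for t :: real by auto
  then have "concat_path p (\<lambda>t. p 1) = (\<lambda>t. p (min 1 (2 * t)))"
    by (simp add: concat_path_def fun_eq_iff)
  then show ?thesis
    using path_class_reparam[OF assms, of "\<lambda>t. min 1 (2 * t)" "\<lambda>t. t"] *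
    by (simp add: continuous_intros)
qed

text \<open>
  Going along a path and back is that path reparametrised by a tent function, which starts and ends
  at 0 and so may be replaced by the constant 0.
\<close>

lemma concat_reverse:
  assumes "pathin X p"
  shows "path_class X (concat_path p (\<lambda>t. p (1 - t))) = path_class X (\<lambda>t. p 0)"
proof -
  have *: "continuous_on {0..1} (\<lambda>t::real. min (2 * t) (2 - 2 * t))" "(\<lambda>t. min (2 * t) (2 - 2 * t)) ` {0..1} \<subseteq> {0..1::real}"
    by (auto intro!: continuous_intros simp: min_le_iff_disj)
  have "concat_path p (\<lambda>t. p (1 - t)) = (\<lambda>t. p (min (2 * t) (2 - 2 * t)))"
    by (auto simp: concat_path_def fun_eq_iff min_def)
  then show ?thesis
    using path_class_reparam[OF assms *, of "\<lambda>t. 0"] by (auto simp: image_constant_conv)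
qed

text \<open>
  The two bracketings run through the same three paths at different speeds; the change of parameter
  is piecewise linear with slopes 1/2, 1 and 2, hence convex, hence a maximum of three affine
  functions, which makes its continuity evident.
\<close>

lemma concat_assoc:
  assumes "pathin X p" "pathin X q" "pathin X r" "p 1 = q 0" "q 1 = r 0"
  shows "path_class X (concat_path p (concat_path q r)) =
         path_class X (concat_path (concat_path p q) r)"
proof -
  let ?\<phi> = "\<lambda>t::real. max (t / 2) (max (t - 1/4) (2 * t - 1))"
  have eq: "concat_path p (concat_path q r) t = concat_path (concat_path p q) r (?\<phi> t)" for t
  proof -
    consider "t \<le> 1/2" | "1/2 < t" "t \<le> 3/4" | "3/4 < t" by linarith
    then show ?thesis
    proof cases
      case 1
      then have "?\<phi> t = t / 2" by auto
      with 1 show ?thesis by (simp add: concat_path_def)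
    next
      case 2
      then have "?\<phi> t = t - 1/4" by auto
      with 2 show ?thesis by (simp add: concat_path_def algebra_simps)
    next
      case 3
      then have "?\<phi> t = 2 * t - 1" by auto
      with 3 show ?thesis by (simp add: concat_path_def algebra_simps)
    qed
  qed
  have "pathin X (concat_path (concat_path p q) r)"
    using assms by (intro pathin_concat) auto
  moreover have "continuous_on {0..1} ?\<phi>" "?\<phi> ` {0..1} \<subseteq> {0..1}"
    by (auto intro!: continuous_intros simp: le_max_iff_disj)
  ultimately have "path_class X (\<lambda>t. concat_path (concat_path p q) r (?\<phi> t)) =
      path_class X (\<lambda>t. concat_path (concat_path p q) r t)"
    by (intro path_class_reparam) auto
  moreover have "concat_path p (concat_path q r) = (\<lambda>t. concat_path (concat_path p q) r (?\<phi> t))"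
    by (rule ext) (rule eq)
  ultimately show ?thesis by (simp only:)
qed

section \<open>The structure of the fundamental groupoid\<close>

lemma fundamental_groupoid_simps [simp]:
  "Ob (fundamental_groupoid T A) = topspace (Top A)"
  "Arr (fundamental_groupoid T A) = {path_class (Top A) p |p. pathin (Top A) p}"
  "Ide (fundamental_groupoid T A) x = path_class (Top A) (\<lambda>t. x)"
  "ObOp (fundamental_groupoid T A) = TOp A"
  by (simp_all add: fundamental_groupoid_def)

lemma path_class_Arr: "pathin (Top A) p \<Longrightarrow> path_class (Top A) p \<in> Arr (fundamental_groupoid T A)"
  by auto

lemma fg_Dom: "pathin (Top A) p \<Longrightarrow> Dom (fundamental_groupoid T A) (path_class (Top A) p) = p 0"
proof -
  assume "pathin (Top A) p"
  then have "p \<in> path_class (Top A) p" by (rule path_class_refl)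
  then have "(\<lambda>q. q 0) ` path_class (Top A) p = {p 0}"
    using path_class_ends(1)[of _ "Top A" p] by blast
  then show ?thesis by (simp add: fundamental_groupoid_def)
qed

lemma fg_Cod: "pathin (Top A) p \<Longrightarrow> Cod (fundamental_groupoid T A) (path_class (Top A) p) = p 1"
proof -
  assume "pathin (Top A) p"
  then have "p \<in> path_class (Top A) p" by (rule path_class_refl)
  then have "(\<lambda>q. q 1) ` path_class (Top A) p = {p 1}"
    using path_class_ends(2)[of _ "Top A" p] by blast
  then show ?thesis by (simp add: fundamental_groupoid_def)
qed

lemma fg_Comp:
  assumes "pathin (Top A) p" "pathin (Top A) q" "p 1 = q 0"
  shows "Comp (fundamental_groupoid T A) (path_class (Top A) q) (path_class (Top A) p) =
         path_class (Top A) (concat_path p q)"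
proof -
  let ?c = "path_class (Top A) p" and ?d = "path_class (Top A) q"
  have "(\<Union>p'\<in>?c. \<Union>q'\<in>?d. path_class (Top A) (concat_path p' q')) =
      (\<Union>p'\<in>?c. \<Union>q'\<in>?d. path_class (Top A) (concat_path p q))"
    by (intro SUP_cong refl path_class_eqI concat_path_class assms(3))
  moreover have "?c \<noteq> {}" "?d \<noteq> {}"
    using path_class_refl[OF assms(1)] path_class_refl[OF assms(2)] by blast+
  ultimately show ?thesis by (simp add: fundamental_groupoid_def)
qed

lemma fg_Inv:
  assumes "pathin (Top A) p"
  shows "Inv (fundamental_groupoid T A) (path_class (Top A) p) = path_class (Top A) (\<lambda>t. p (1 - t))"
  unfolding fundamental_groupoid_def
  by (simp add: UN_path_class[OF assms, where F = "\<lambda>p t. p (1 - t)"] reverse_path_class)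

lemma fg_Hom_iff:
  "c \<in> Hom (fundamental_groupoid T A) a b \<longleftrightarrow>
     (\<exists>p. pathin (Top A) p \<and> p 0 = a \<and> p 1 = b \<and> c = path_class (Top A) p)"
  unfolding Hom_def by (auto simp: fg_Dom fg_Cod)

lemma fundamental_groupoid_is_category: "is_category (fundamental_groupoid T A)"
  unfolding is_category_def
proof (intro conjI allI ballI)
  let ?G = "fundamental_groupoid T A" and ?X = "Top A"
  fix c assume "c \<in> Arr ?G"
  then show "Dom ?G c \<in> Ob ?G" "Cod ?G c \<in> Ob ?G"
    by (auto simp: fg_Dom fg_Cod pathin_ends)
next
  fix a assume "a \<in> Ob (fundamental_groupoid T A)"
  then show "Ide (fundamental_groupoid T A) a \<in> Hom (fundamental_groupoid T A) a a"
    unfolding fg_Hom_iff by (auto simp: pathin_const_iff intro!: exI[of _ "\<lambda>t. a"])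
next
  fix a b c f g
  assume "f \<in> Hom (fundamental_groupoid T A) a b" "g \<in> Hom (fundamental_groupoid T A) b c"
  then obtain p q where pq: "pathin (Top A) p" "p 0 = a" "p 1 = b" "f = path_class (Top A) p"
     "pathin (Top A) q" "q 0 = b" "q 1 = c" "g = path_class (Top A) q"
    unfolding fg_Hom_iff by blast
  then show "Comp (fundamental_groupoid T A) g f \<in> Hom (fundamental_groupoid T A) a c"
    unfolding fg_Hom_iff by (intro exI[of _ "concat_path p q"]) (simp add: fg_Comp pathin_concat)
next
  fix a b f assume "f \<in> Hom (fundamental_groupoid T A) a b"
  then obtain p where p: "pathin (Top A) p" "p 0 = a" "p 1 = b" "f = path_class (Top A) p"
    unfolding fg_Hom_iff by blast
  note ends = pathin_ends[OF p(1), unfolded p, folded pathin_const_iff]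
  show "Comp (fundamental_groupoid T A) f (Ide (fundamental_groupoid T A) a) = f"
    using p ends concat_const_left[OF p(1)] by (simp add: fg_Comp)
  show "Comp (fundamental_groupoid T A) (Ide (fundamental_groupoid T A) b) f = f"
    using p ends concat_const_right[OF p(1)] by (simp add: fg_Comp)
next
  fix a b c d f g h
  assume "f \<in> Hom (fundamental_groupoid T A) a b" "g \<in> Hom (fundamental_groupoid T A) b c"
    "h \<in> Hom (fundamental_groupoid T A) c d"
  then obtain p q r where "pathin (Top A) p" "p 1 = b" "f = path_class (Top A) p"
     "pathin (Top A) q" "q 0 = b" "q 1 = c" "g = path_class (Top A) q"
     "pathin (Top A) r" "r 0 = c" "h = path_class (Top A) r"
    unfolding fg_Hom_iff by blast
  then show "Comp (fundamental_groupoid T A) h (Comp (fundamental_groupoid T A) g f) =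
      Comp (fundamental_groupoid T A) (Comp (fundamental_groupoid T A) h g) f"
    by (simp add: fg_Comp pathin_concat concat_assoc)
qed

lemma fundamental_groupoid_is_groupoid: "is_groupoid (fundamental_groupoid T A)"
  unfolding is_groupoid_def
proof (intro conjI allI ballI fundamental_groupoid_is_category)
  fix a b f assume "f \<in> Hom (fundamental_groupoid T A) a b"
  then obtain p where p: "pathin (Top A) p" "p 0 = a" "p 1 = b" "f = path_class (Top A) p"
    unfolding fg_Hom_iff by blast
  let ?r = "\<lambda>t. p (1 - t)"
  have r: "pathin (Top A) ?r" using p(1) by (rule pathin_reverse)
  show "Inv (fundamental_groupoid T A) f \<in> Hom (fundamental_groupoid T A) b a"
    unfolding fg_Hom_iff using p r by (intro exI[of _ ?r]) (simp add: fg_Inv)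
  show "Comp (fundamental_groupoid T A) (Inv (fundamental_groupoid T A) f) f =
      Ide (fundamental_groupoid T A) a"
    using p r concat_reverse[OF p(1)] by (simp add: fg_Inv fg_Comp)
  show "Comp (fundamental_groupoid T A) f (Inv (fundamental_groupoid T A) f) =
      Ide (fundamental_groupoid T A) b"
    using p r concat_reverse[OF r] by (simp add: fg_Inv fg_Comp)
qed

section \<open>The operations on classes of paths\<close>

lemma continuous_map_top_alg_op:
  assumes "is_top_alg T A" "\<tau> \<in> Hom T n 1" "\<And>i. i < n \<Longrightarrow> continuous_map Z (Top A) (h i)"
  shows "continuous_map Z (Top A) (\<lambda>z. TOp A \<tau> (\<lambda>i\<in>{..<n}. h i z))"
proof -
  have "continuous_map Z (product_topology (\<lambda>i. Top A) {..<n}) (\<lambda>z. \<lambda>i\<in>{..<n}. h i z)"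
    using assms(3) by (auto simp: continuous_map_componentwise)
  moreover have "continuous_map (product_topology (\<lambda>i. Top A) {..<n}) (Top A) (TOp A \<tau>)"
    using assms(1,2) unfolding is_top_alg_def by blast
  ultimately show ?thesis
    using continuous_map_compose[of Z _ _ "Top A" "TOp A \<tau>"] by (auto simp: o_def)
qed

lemma pathin_op:
  assumes "is_top_alg T A" "\<tau> \<in> Hom T n 1" "\<forall>i<n. pathin (Top A) (\<beta> i)"
  shows "pathin (Top A) (\<lambda>t. TOp A \<tau> (\<lambda>i\<in>{..<n}. \<beta> i t))"
  using assms unfolding pathin_def by (intro continuous_map_top_alg_op) auto

text \<open>
  The operation is applied to a tuple of homotopies at each point of the square.
\<close>

lemma op_path_class:
  assumes A: "is_top_alg T A" "\<tau> \<in> Hom T n 1"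
    and \<gamma>: "\<And>i. i < n \<Longrightarrow> \<gamma> i \<in> path_class (Top A) (\<beta> i)"
  shows "(\<lambda>t. TOp A \<tau> (\<lambda>i\<in>{..<n}. \<gamma> i t)) \<in>
         path_class (Top A) (\<lambda>t. TOp A \<tau> (\<lambda>i\<in>{..<n}. \<beta> i t))"
proof -
  have "\<forall>i. \<exists>H. i < n \<longrightarrow>
      continuous_map unit_square (Top A) H \<and>
      (\<forall>t\<in>{0..1}. H (0, t) = \<beta> i t \<and> H (1, t) = \<gamma> i t) \<and>
      (\<forall>s\<in>{0..1}. H (s, 0) = \<beta> i 0 \<and> H (s, 1) = \<beta> i 1)"
    using \<gamma> unfolding mem_path_class_iff by blast
  then obtain H where H: "\<And>i. i < n \<Longrightarrow>
      continuous_map unit_square (Top A) (H i) \<and>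
      (\<forall>t\<in>{0..1}. H i (0, t) = \<beta> i t \<and> H i (1, t) = \<gamma> i t) \<and>
      (\<forall>s\<in>{0..1}. H i (s, 0) = \<beta> i 0 \<and> H i (s, 1) = \<beta> i 1)"
    by metis
  show ?thesis
  proof (rule mem_path_classI)
    show "continuous_map unit_square (Top A)
        (\<lambda>z. TOp A \<tau> (\<lambda>i\<in>{..<n}. H i z))"
      using A H by (intro continuous_map_top_alg_op) auto
  qed (use H in \<open>auto intro!: arg_cong[where f = "TOp A \<tau>"] restrict_ext\<close>)
qed

text \<open>
  Only the first \<open>n\<close> entries of \<open>c\<close> are constrained, so the rule applies to restricted tuples as
  they occur in the algebra axioms.
\<close>

lemma fg_ArrOp:
  assumes A: "is_top_alg T A" "\<tau> \<in> Hom T n 1"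
    and \<beta>: "\<forall>i<n. pathin (Top A) (\<beta> i)" "\<forall>i<n. c i = path_class (Top A) (\<beta> i)"
  shows "ArrOp (fundamental_groupoid T A) \<tau> c =
         path_class (Top A) (\<lambda>t. TOp A \<tau> (\<lambda>i\<in>{..<n}. \<beta> i t))"
proof -
  have "path_class (Top A) (\<lambda>t. TOp A \<tau> (\<lambda>i\<in>{..<n}. \<gamma> i t)) =
      path_class (Top A) (\<lambda>t. TOp A \<tau> (\<lambda>i\<in>{..<n}. \<beta> i t))"
    if "\<gamma> \<in> (\<Pi>\<^sub>E i\<in>{..<n}. c i)" for \<gamma>
  proof -
    have "\<gamma> i \<in> path_class (Top A) (\<beta> i)" if "i < n" for i
      using \<beta>(2) \<open>\<gamma> \<in> _\<close> that by auto
    then show ?thesis by (intro path_class_eqI op_path_class[OF A])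
  qed
  moreover have "restrict \<beta> {..<n} \<in> (\<Pi>\<^sub>E i\<in>{..<n}. c i)"
    using \<beta> path_class_refl[of "Top A"] by (auto simp: PiE_iff)
  ultimately have "(\<lambda>\<gamma>. path_class (Top A) (\<lambda>t. TOp A \<tau> (\<lambda>i\<in>{..<n}. \<gamma> i t))) `
      (\<Pi>\<^sub>E i\<in>{..<n}. c i) = {path_class (Top A) (\<lambda>t. TOp A \<tau> (\<lambda>i\<in>{..<n}. \<beta> i t))}"
    by blast
  then show ?thesis
    by (simp add: fundamental_groupoid_def HomD(1)[OF A(2)])
qed

lemma arr_tupleE:
  assumes "x \<in> tuples n (Arr (fundamental_groupoid T A))"
  obtains \<beta> where "\<forall>i<n. pathin (Top A) (\<beta> i)" "\<forall>i<n. x i = path_class (Top A) (\<beta> i)"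
proof -
  have "\<forall>i. \<exists>p. i < n \<longrightarrow> pathin (Top A) p \<and> x i = path_class (Top A) p"
    using assms unfolding fundamental_groupoid_simps PiE_iff by blast
  then show ?thesis using that by metis
qed

lemma pathin_tuple:
  assumes "\<forall>i<n. pathin X (\<beta> i)" "t \<in> {0..1}"
  shows "(\<lambda>i\<in>{..<n}. \<beta> i t) \<in> tuples n (topspace X)"
  using assms unfolding pathin_def continuous_map_def by (auto simp: Pi_iff)

lemma arr_alg_is_alg:
  assumes T: "algebraic_theory T" and A: "is_top_alg T A"
  shows "is_alg T (arr_alg (fundamental_groupoid T A))"
proof -
  let ?G = "fundamental_groupoid T A"
  have alg: "is_alg T (alg_of A)" using A by (simp add: is_top_alg_def)
  show ?thesis
    unfolding is_alg_def arr_alg_def alg.simps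
  proof (intro conjI allI ballI impI Pi_I)
    fix n \<tau> x assume \<tau>: "\<tau> \<in> Hom T n 1" and x: "x \<in> tuples n (Arr ?G)"
    from x obtain \<beta> where \<beta>: "\<forall>i<n. pathin (Top A) (\<beta> i)"
      "\<forall>i<n. x i = path_class (Top A) (\<beta> i)" by (rule arr_tupleE)
    show "ArrOp ?G \<tau> x \<in> Arr ?G"
      unfolding fg_ArrOp[OF A \<tau> \<beta>] by (intro path_class_Arr pathin_op[OF A \<tau> \<beta>(1)])
  next
    fix n i x assume i: "i < n" and x: "x \<in> tuples n (Arr ?G)"
    from x obtain \<beta> where \<beta>: "\<forall>i<n. pathin (Top A) (\<beta> i)"
      "\<forall>i<n. x i = path_class (Top A) (\<beta> i)" by (rule arr_tupleE)
    have "TOp A (Proj T n i) (\<lambda>i\<in>{..<n}. \<beta> i t) = \<beta> i t" if "t \<in> {0..1}" for t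
      using alg pathin_tuple[OF \<beta>(1) that] i
      unfolding is_alg_def alg_of_def by auto
    then show "ArrOp ?G (Proj T n i) x = x i"
      unfolding fg_ArrOp[OF A theory_Proj[OF T i] \<beta>] using \<beta> i
      by (auto intro!: path_class_cong)
  next
    fix m n f \<tau> x
    assume f: "f \<in> Hom T m n" and \<tau>: "\<tau> \<in> Hom T n 1" and x: "x \<in> tuples m (Arr ?G)"
    from x obtain \<beta> where \<beta>: "\<forall>i<m. pathin (Top A) (\<beta> i)"
      "\<forall>i<m. x i = path_class (Top A) (\<beta> i)" by (rule arr_tupleE)
    let ?\<gamma> = "\<lambda>i t. TOp A (Comp T (Proj T n i) f) (\<lambda>j\<in>{..<m}. \<beta> j t)"
    have pf: "Comp T (Proj T n i) f \<in> Hom T m 1" if "i < n" for i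
      using theory_Comp[OF T f theory_Proj[OF T that]] .
    have \<gamma>: "\<forall>i<n. pathin (Top A) (?\<gamma> i)"
      using pathin_op[OF A pf \<beta>(1)] by blast
    have "ArrOp ?G (Comp T \<tau> f) x =
        path_class (Top A) (\<lambda>t. TOp A (Comp T \<tau> f) (\<lambda>j\<in>{..<m}. \<beta> j t))"
      using fg_ArrOp[OF A theory_Comp[OF T f \<tau>] \<beta>] .
    also have "\<dots> = path_class (Top A) (\<lambda>t. TOp A \<tau> (\<lambda>i\<in>{..<n}. ?\<gamma> i t))"
    proof (rule path_class_cong)
      show "pathin (Top A) (\<lambda>t. TOp A \<tau> (\<lambda>i\<in>{..<n}. ?\<gamma> i t))" by (rule pathin_op[OF A \<tau> \<gamma>])
      show "TOp A (Comp T \<tau> f) (\<lambda>j\<in>{..<m}. \<beta> j t) = TOp A \<tau> (\<lambda>i\<in>{..<n}. ?\<gamma> i t)"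
        if "t \<in> {0..1}" for t
        using alg_compD[OF alg f \<tau>, of "\<lambda>j\<in>{..<m}. \<beta> j t"] pathin_tuple[OF \<beta>(1) that]
        by (simp add: alg_of_def)
    qed
    also have "\<dots> = ArrOp ?G \<tau> (\<lambda>i\<in>{..<n}. ArrOp ?G (Comp T (Proj T n i) f) x)"
      by (rule fg_ArrOp[OF A \<tau> \<gamma>, symmetric]) (simp add: fg_ArrOp[OF A pf \<beta>])
    finally show "ArrOp ?G (Comp T \<tau> f) x =
        ArrOp ?G \<tau> (\<lambda>i\<in>{..<n}. ArrOp ?G (Comp T (Proj T n i) f) x)" .
  qed
qed

lemma fundamental_groupoid_is_int_groupoid:
  assumes T: "algebraic_theory T" and A: "is_top_alg T A"
  shows "is_int_groupoid T (fundamental_groupoid T A)"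
proof -
  let ?G = "fundamental_groupoid T A"
  have alg: "is_alg T (alg_of A)" using A by (simp add: is_top_alg_def)
  have ob: "ob_alg ?G = alg_of A" by (simp add: ob_alg_def alg_of_def)
  have cat: "is_category ?G" by (rule fundamental_groupoid_is_category)
  have "is_alg_hom T (arr_alg ?G) (alg_of A) (Dom ?G)"
    unfolding is_alg_hom_def arr_alg_def alg_of_def alg.simps
  proof (intro conjI allI ballI Pi_I)
    fix n \<tau> x assume \<tau>: "\<tau> \<in> Hom T n 1" and x: "x \<in> tuples n (Arr ?G)"
    from x obtain \<beta> where \<beta>: "\<forall>i<n. pathin (Top A) (\<beta> i)"
      "\<forall>i<n. x i = path_class (Top A) (\<beta> i)" by (rule arr_tupleE)
    show "Dom ?G (ArrOp ?G \<tau> x) = TOp A \<tau> (\<lambda>i\<in>{..<n}. Dom ?G (x i))"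
      unfolding fg_ArrOp[OF A \<tau> \<beta>] fg_Dom[OF pathin_op[OF A \<tau> \<beta>(1)]]
      by (intro arg_cong[where f = "TOp A \<tau>"] restrict_ext) (simp add: fg_Dom \<beta>)
  qed (auto simp: fg_Dom pathin_ends)
  moreover have "is_alg_hom T (arr_alg ?G) (alg_of A) (Cod ?G)"
    unfolding is_alg_hom_def arr_alg_def alg_of_def alg.simps
  proof (intro conjI allI ballI Pi_I)
    fix n \<tau> x assume \<tau>: "\<tau> \<in> Hom T n 1" and x: "x \<in> tuples n (Arr ?G)"
    from x obtain \<beta> where \<beta>: "\<forall>i<n. pathin (Top A) (\<beta> i)"
      "\<forall>i<n. x i = path_class (Top A) (\<beta> i)" by (rule arr_tupleE)
    show "Cod ?G (ArrOp ?G \<tau> x) = TOp A \<tau> (\<lambda>i\<in>{..<n}. Cod ?G (x i))"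
      unfolding fg_ArrOp[OF A \<tau> \<beta>] fg_Cod[OF pathin_op[OF A \<tau> \<beta>(1)]]
      by (intro arg_cong[where f = "TOp A \<tau>"] restrict_ext) (simp add: fg_Cod \<beta>)
  qed (auto simp: fg_Cod pathin_ends)
  moreover have "is_alg_hom T (alg_of A) (arr_alg ?G) (Ide ?G)"
    unfolding is_alg_hom_def arr_alg_def alg_of_def alg.simps
  proof (intro conjI allI ballI Pi_I)
    fix n \<tau> x assume \<tau>: "\<tau> \<in> Hom T n 1" and x: "x \<in> tuples n (topspace (Top A))"
    then have "ArrOp ?G \<tau> (\<lambda>i\<in>{..<n}. Ide ?G (x i)) =
        path_class (Top A) (\<lambda>t. TOp A \<tau> (\<lambda>i\<in>{..<n}. x i))"
      by (intro fg_ArrOp[OF A \<tau>]) (auto simp: pathin_const_iff PiE_iff)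
    moreover have "(\<lambda>i\<in>{..<n}. x i) = x" using x by (simp add: PiE_restrict)
    ultimately show "Ide ?G (TOp A \<tau> x) = ArrOp ?G \<tau> (\<lambda>i\<in>{..<n}. Ide ?G (x i))" by simp
  next
    fix x assume "x \<in> topspace (Top A)"
    then show "Ide ?G x \<in> Arr ?G"
      unfolding fundamental_groupoid_simps(3) by (intro path_class_Arr) (simp add: pathin_const_iff)
  qed
  moreover have "is_alg_hom T (pair_alg T ?G) (arr_alg ?G) (\<lambda>(g, f). Comp ?G g f)"
    unfolding is_alg_hom_def arr_alg_def pair_alg_def alg.simps
  proof (intro conjI allI ballI Pi_I)
    fix n \<tau> x
    assume \<tau>: "\<tau> \<in> Hom T n 1"
      and x: "x \<in> tuples n {(g, f). g \<in> Arr ?G \<and> f \<in> Arr ?G \<and> Dom ?G g = Cod ?G f}"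
    then have "(\<lambda>i\<in>{..<n}. snd (x i)) \<in> tuples n (Arr ?G)"
      "(\<lambda>i\<in>{..<n}. fst (x i)) \<in> tuples n (Arr ?G)"
      by (auto simp del: fundamental_groupoid_simps simp: PiE_iff case_prod_unfold)
    then obtain \<beta> \<gamma> where \<beta>: "\<forall>i<n. pathin (Top A) (\<beta> i)"
      "\<forall>i<n. (\<lambda>i\<in>{..<n}. snd (x i)) i = path_class (Top A) (\<beta> i)"
      and \<gamma>: "\<forall>i<n. pathin (Top A) (\<gamma> i)"
      "\<forall>i<n. (\<lambda>i\<in>{..<n}. fst (x i)) i = path_class (Top A) (\<gamma> i)"
      by (elim arr_tupleE)
    have ends: "\<beta> i 1 = \<gamma> i 0" if "i < n" for i
    proof -
      have "Dom ?G (fst (x i)) = Cod ?G (snd (x i))"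
        using x that by (simp add: PiE_iff case_prod_unfold del: fundamental_groupoid_simps)
      then show ?thesis using that \<beta> \<gamma> by (simp add: fg_Dom fg_Cod)
    qed
    let ?b = "\<lambda>t. TOp A \<tau> (\<lambda>i\<in>{..<n}. \<beta> i t)" and ?c = "\<lambda>t. TOp A \<tau> (\<lambda>i\<in>{..<n}. \<gamma> i t)"
    have "Comp ?G (ArrOp ?G \<tau> (\<lambda>i\<in>{..<n}. fst (x i))) (ArrOp ?G \<tau> (\<lambda>i\<in>{..<n}. snd (x i))) =
        path_class (Top A) (concat_path ?b ?c)"
      unfolding fg_ArrOp[OF A \<tau> \<beta>] fg_ArrOp[OF A \<tau> \<gamma>]
      by (intro fg_Comp pathin_op[OF A \<tau>] \<beta>(1) \<gamma>(1) arg_cong[where f = "TOp A \<tau>"] restrict_ext)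
         (auto simp: ends)
    \<comment> \<open>concatenation chooses between its two arguments by the parameter alone, independently of \<open>i\<close>\<close>
    also have "concat_path ?b ?c = (\<lambda>t. TOp A \<tau> (\<lambda>i\<in>{..<n}. concat_path (\<beta> i) (\<gamma> i) t))"
      by (auto simp: concat_path_def)
    also have "path_class (Top A) \<dots> = ArrOp ?G \<tau> (\<lambda>i\<in>{..<n}. case x i of (g, f) \<Rightarrow> Comp ?G g f)"
    proof (rule fg_ArrOp[OF A \<tau>, symmetric])
      show "\<forall>i<n. pathin (Top A) (concat_path (\<beta> i) (\<gamma> i))"
        using \<beta>(1) \<gamma>(1) ends by (simp add: pathin_concat)
      show "\<forall>i<n. (\<lambda>i\<in>{..<n}. case x i of (g, f) \<Rightarrow> Comp ?G g f) i =
          path_class (Top A) (concat_path (\<beta> i) (\<gamma> i))"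
        using \<beta> \<gamma> ends by (simp add: case_prod_unfold fg_Comp)
    qed
    finally show "(case (ArrOp ?G \<tau> (\<lambda>i\<in>{..<Dom T \<tau>}. fst (x i)),
        ArrOp ?G \<tau> (\<lambda>i\<in>{..<Dom T \<tau>}. snd (x i))) of (g, f) \<Rightarrow> Comp ?G g f) =
      ArrOp ?G \<tau> (\<lambda>i\<in>{..<n}. case x i of (g, f) \<Rightarrow> Comp ?G g f)"
      by (simp only: HomD(1)[OF \<tau>] prod.case)
  next
    fix z assume "z \<in> {(g, f). g \<in> Arr ?G \<and> f \<in> Arr ?G \<and> Dom ?G g = Cod ?G f}"
    then have z: "fst z \<in> Hom ?G (Cod ?G (snd z)) (Cod ?G (fst z))"
      "snd z \<in> Hom ?G (Dom ?G (snd z)) (Cod ?G (snd z))"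
      by (auto simp: Hom_def)
    show "(case z of (g, f) \<Rightarrow> Comp ?G g f) \<in> Arr ?G"
      using category_Comp[OF cat z(2,1)]
      by (simp add: Hom_def case_prod_unfold del: fundamental_groupoid_simps)
  qed
  moreover have "is_alg_hom T (arr_alg ?G) (arr_alg ?G) (Inv ?G)"
    unfolding is_alg_hom_def arr_alg_def alg.simps
  proof (intro conjI allI ballI Pi_I)
    fix n \<tau> x assume \<tau>: "\<tau> \<in> Hom T n 1" and x: "x \<in> tuples n (Arr ?G)"
    from x obtain \<beta> where \<beta>: "\<forall>i<n. pathin (Top A) (\<beta> i)"
      "\<forall>i<n. x i = path_class (Top A) (\<beta> i)" by (rule arr_tupleE)
    show "Inv ?G (ArrOp ?G \<tau> x) = ArrOp ?G \<tau> (\<lambda>i\<in>{..<n}. Inv ?G (x i))"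
      unfolding fg_ArrOp[OF A \<tau> \<beta>] fg_Inv[OF pathin_op[OF A \<tau> \<beta>(1)]]
      by (rule fg_ArrOp[OF A \<tau>, symmetric]) (auto simp: \<beta> fg_Inv intro: pathin_reverse)
  next
    fix c assume "c \<in> Arr ?G"
    then obtain p where p: "pathin (Top A) p" "c = path_class (Top A) p" by auto
    show "Inv ?G c \<in> Arr ?G"
      unfolding p(2) fg_Inv[OF p(1)] by (rule path_class_Arr[OF pathin_reverse[OF p(1)]])
  qed
  ultimately show ?thesis
    using fundamental_groupoid_is_groupoid arr_alg_is_alg[OF T A] alg
    unfolding is_int_groupoid_def ob by (intro conjI)
qed

section \<open>The categories of topological algebras and of internal groupoids\<close>

lemma top_alg_cat_simps [simp]:
  "Ob (top_alg_cat T) = {A. is_top_alg T A}"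
  "Dom (top_alg_cat T) = MDom" "Cod (top_alg_cat T) = MCod"
  "Ide (top_alg_cat T) A = \<lparr>MDom = A, MCod = A, MMap = (\<lambda>x\<in>topspace (Top A). x)\<rparr>"
  "Comp (top_alg_cat T) g f = \<lparr>MDom = MDom f, MCod = MCod g,
     MMap = compose (topspace (Top (MDom f))) (MMap g) (MMap f)\<rparr>"
  by (simp_all add: top_alg_cat_def)

lemma top_alg_cat_Hom_iff:
  "f \<in> Hom (top_alg_cat T) A B \<longleftrightarrow>
     MDom f = A \<and> MCod f = B \<and> is_top_alg T A \<and> is_top_alg T B \<and>
     continuous_map (Top A) (Top B) (MMap f) \<and> is_alg_hom T (alg_of A) (alg_of B) (MMap f) \<and>
     MMap f \<in> extensional (topspace (Top A))"
  by (auto simp: Hom_def top_alg_cat_def)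

lemma Carr_alg_of [simp]: "Carr (alg_of A) = topspace (Top A)"
  by (simp add: alg_of_def)

lemma is_top_alg_imp_alg: "is_top_alg T A \<Longrightarrow> is_alg T (alg_of A)"
  by (simp add: is_top_alg_def)

lemma continuous_map_compose_ext:
  assumes "continuous_map X Y f" "continuous_map Y Z g"
  shows "continuous_map X Z (compose (topspace X) g f)"
  using continuous_map_compose[OF assms] by (rule continuous_map_eq) (simp add: compose_eq)

lemma top_alg_cat_is_category: "is_category (top_alg_cat T)"
  unfolding is_category_def
proof (intro conjI allI ballI)
  fix f assume "f \<in> Arr (top_alg_cat T)"
  then show "Dom (top_alg_cat T) f \<in> Ob (top_alg_cat T)" "Cod (top_alg_cat T) f \<in> Ob (top_alg_cat T)"
    by (auto simp: top_alg_cat_def)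
next
  fix A assume "A \<in> Ob (top_alg_cat T)"
  then have A: "is_top_alg T A" by simp
  have "continuous_map (Top A) (Top A) (\<lambda>x\<in>topspace (Top A). x)"
    by (rule continuous_map_eq[OF continuous_map_id]) simp
  then show "Ide (top_alg_cat T) A \<in> Hom (top_alg_cat T) A A"
    using A is_alg_hom_Id[OF is_top_alg_imp_alg[OF A]] by (simp add: top_alg_cat_Hom_iff)
next
  fix A B C f g assume f: "f \<in> Hom (top_alg_cat T) A B" and g: "g \<in> Hom (top_alg_cat T) B C"
  then show "Comp (top_alg_cat T) g f \<in> Hom (top_alg_cat T) A C"
    using is_alg_hom_compose[of T "alg_of A" "alg_of B" "MMap f" "alg_of C" "MMap g"]
    by (auto simp: top_alg_cat_Hom_iff continuous_map_compose_ext is_top_alg_imp_alg)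
next
  fix A B f assume f: "f \<in> Hom (top_alg_cat T) A B"
  then have "MMap f \<in> topspace (Top A) \<rightarrow> topspace (Top B)" "MMap f \<in> extensional (topspace (Top A))"
    by (auto simp: top_alg_cat_Hom_iff is_alg_hom_def)
  then show "Comp (top_alg_cat T) f (Ide (top_alg_cat T) A) = f"
    "Comp (top_alg_cat T) (Ide (top_alg_cat T) B) f = f"
    using f by (auto simp: top_alg_cat_Hom_iff compose_Id Id_compose intro!: mor.equality)
next
  fix A B C D f g h
  assume "f \<in> Hom (top_alg_cat T) A B" "g \<in> Hom (top_alg_cat T) B C" "h \<in> Hom (top_alg_cat T) C D"
  then show "Comp (top_alg_cat T) h (Comp (top_alg_cat T) g f) =
      Comp (top_alg_cat T) (Comp (top_alg_cat T) h g) f"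
    by (auto simp: top_alg_cat_Hom_iff is_alg_hom_def intro: compose_assoc)
qed

lemma int_groupoid_cat_simps [simp]:
  "Ob (int_groupoid_cat T) = {G. is_int_groupoid T G}"
  "Dom (int_groupoid_cat T) = MDom" "Cod (int_groupoid_cat T) = MCod"
  "Ide (int_groupoid_cat T) G = \<lparr>MDom = G, MCod = G, MMap = (\<lambda>x\<in>Ob G. x, \<lambda>c\<in>Arr G. c)\<rparr>"
  "Comp (int_groupoid_cat T) K F = \<lparr>MDom = MDom F, MCod = MCod K,
     MMap = (compose (Ob (MDom F)) (fst (MMap K)) (fst (MMap F)),
             compose (Arr (MDom F)) (snd (MMap K)) (snd (MMap F)))\<rparr>"
  by (simp_all add: int_groupoid_cat_def)

lemma int_groupoid_cat_Hom_iff: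
  "F \<in> Hom (int_groupoid_cat T) G H \<longleftrightarrow>
     MDom F = G \<and> MCod F = H \<and> is_int_groupoid T G \<and> is_int_groupoid T H \<and>
     is_functor G H (fst (MMap F)) (snd (MMap F)) \<and>
     is_alg_hom T (ob_alg G) (ob_alg H) (fst (MMap F)) \<and>
     is_alg_hom T (arr_alg G) (arr_alg H) (snd (MMap F)) \<and>
     fst (MMap F) \<in> extensional (Ob G) \<and> snd (MMap F) \<in> extensional (Arr G)"
  by (auto simp: Hom_def int_groupoid_cat_def)

lemma Carr_ob_alg [simp]: "Carr (ob_alg G) = Ob G"
  and Carr_arr_alg [simp]: "Carr (arr_alg G) = Arr G"
  by (simp_all add: ob_alg_def arr_alg_def)

lemma is_int_groupoidD:
  assumes "is_int_groupoid T G"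
  shows "is_category G" "is_alg T (ob_alg G)" "is_alg T (arr_alg G)"
  using assms by (simp_all add: is_int_groupoid_def is_groupoid_def)

lemma int_groupoid_cat_is_category: "is_category (int_groupoid_cat T)"
  unfolding is_category_def
proof (intro conjI allI ballI)
  fix F assume "F \<in> Arr (int_groupoid_cat T)"
  then show "Dom (int_groupoid_cat T) F \<in> Ob (int_groupoid_cat T)"
    "Cod (int_groupoid_cat T) F \<in> Ob (int_groupoid_cat T)"
    by (auto simp: int_groupoid_cat_def)
next
  fix G assume "G \<in> Ob (int_groupoid_cat T)"
  then have G: "is_int_groupoid T G" by simp
  note * = is_int_groupoidD[OF G]
  show "Ide (int_groupoid_cat T) G \<in> Hom (int_groupoid_cat T) G G"
    using G is_alg_hom_Id[OF *(2)] is_alg_hom_Id[OF *(3)] is_functor_Id[OF *(1)]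
    by (simp add: int_groupoid_cat_Hom_iff)
next
  fix G H I F K
  assume FK: "F \<in> Hom (int_groupoid_cat T) G H" "K \<in> Hom (int_groupoid_cat T) H I"
  then have G: "is_int_groupoid T G" by (simp add: int_groupoid_cat_Hom_iff)
  show "Comp (int_groupoid_cat T) K F \<in> Hom (int_groupoid_cat T) G I"
    using FK is_functor_compose[of G H _ _ I]
      is_alg_hom_compose[OF is_int_groupoidD(2)[OF G], of "ob_alg H" _ "ob_alg I"]
      is_alg_hom_compose[OF is_int_groupoidD(3)[OF G], of "arr_alg H" _ "arr_alg I"]
    by (simp add: int_groupoid_cat_Hom_iff)
next
  fix G H F assume F: "F \<in> Hom (int_groupoid_cat T) G H"
  then have "fst (MMap F) \<in> Ob G \<rightarrow> Ob H" "fst (MMap F) \<in> extensional (Ob G)"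
    "snd (MMap F) \<in> Arr G \<rightarrow> Arr H" "snd (MMap F) \<in> extensional (Arr G)"
    by (auto simp: int_groupoid_cat_Hom_iff is_alg_hom_def)
  then show "Comp (int_groupoid_cat T) F (Ide (int_groupoid_cat T) G) = F"
    "Comp (int_groupoid_cat T) (Ide (int_groupoid_cat T) H) F = F"
    using F by (auto simp: int_groupoid_cat_Hom_iff compose_Id Id_compose intro!: mor.equality)
next
  fix G H I J F K L
  assume "F \<in> Hom (int_groupoid_cat T) G H" "K \<in> Hom (int_groupoid_cat T) H I"
    "L \<in> Hom (int_groupoid_cat T) I J"
  then show "Comp (int_groupoid_cat T) L (Comp (int_groupoid_cat T) K F) =
      Comp (int_groupoid_cat T) (Comp (int_groupoid_cat T) L K) F"
    by (auto simp: int_groupoid_cat_Hom_iff is_alg_hom_def intro: compose_assoc)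
qed

section \<open>Functoriality\<close>

lemma pathin_image: "pathin X p \<Longrightarrow> continuous_map X Y f \<Longrightarrow> pathin Y (f \<circ> p)"
  unfolding pathin_def by (rule continuous_map_compose)

lemma image_path_class:
  assumes "continuous_map X Y f" "q \<in> path_class X p"
  shows "f \<circ> q \<in> path_class Y (f \<circ> p)"
proof -
  obtain H where H: "continuous_map unit_square X H"
    "\<forall>t\<in>{0..1}. H (0, t) = p t \<and> H (1, t) = q t" "\<forall>s\<in>{0..1}. H (s, 0) = p 0 \<and> H (s, 1) = p 1"
    using assms(2) unfolding mem_path_class_iff by blast
  show ?thesis
    by (rule mem_path_classI[OF continuous_map_compose[OF H(1) assms(1)]]) (use H in auto)
qed

text \<open>
  The action on arrows is post-composition with any representative, since post-composition
  respects homotopies.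
\<close>

lemma fundamental_groupoid_map_class:
  assumes "f \<in> Hom (top_alg_cat T) A B" "pathin (Top A) p"
  shows "snd (MMap (fundamental_groupoid_map T f)) (path_class (Top A) p) =
         path_class (Top B) (MMap f \<circ> p)"
proof -
  have "continuous_map (Top A) (Top B) (MMap f)" "MDom f = A" "MCod f = B"
    using assms(1) by (simp_all add: top_alg_cat_Hom_iff)
  moreover from this have "(\<Union>q\<in>path_class (Top A) p. path_class (Top B) (MMap f \<circ> q)) =
      path_class (Top B) (MMap f \<circ> p)"
    using assms(2) by (intro UN_path_class image_path_class)
  ultimately show ?thesis
    using path_class_Arr[OF assms(2), of T]
    by (simp add: fundamental_groupoid_map_def del: fundamental_groupoid_simps)
qed

lemma image_concat_path: "f \<circ> concat_path p q = concat_path (f \<circ> p) (f \<circ> q)"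
  by (auto simp: concat_path_def)

lemma fundamental_groupoid_map_Hom:
  assumes T: "algebraic_theory T" and f: "f \<in> Hom (top_alg_cat T) A B"
  shows "fundamental_groupoid_map T f \<in>
    Hom (int_groupoid_cat T) (fundamental_groupoid T A) (fundamental_groupoid T B)"
proof -
  let ?G = "fundamental_groupoid T A" and ?H = "fundamental_groupoid T B"
  let ?F = "fundamental_groupoid_map T f" and ?f = "MMap f"
  have A: "is_top_alg T A" and B: "is_top_alg T B" and dom: "MDom f = A" "MCod f = B"
    and cont: "continuous_map (Top A) (Top B) ?f"
    and hom: "is_alg_hom T (alg_of A) (alg_of B) ?f" and ext: "?f \<in> extensional (topspace (Top A))"
    using f by (auto simp: top_alg_cat_Hom_iff)
  have F: "MDom ?F = ?G" "MCod ?F = ?H" "fst (MMap ?F) = ?f" "snd (MMap ?F) \<in> extensional (Arr ?G)"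
    by (simp_all add: fundamental_groupoid_map_def dom)
  note cls = fundamental_groupoid_map_class[OF f]
  note im = pathin_image[OF _ cont]
  have op: "?f (TOp A \<tau> x) = TOp B \<tau> (\<lambda>i\<in>{..<n}. ?f (x i))"
    if "\<tau> \<in> Hom T n 1" "x \<in> tuples n (topspace (Top A))" for n \<tau> x
    using hom that by (simp add: is_alg_hom_def alg_of_def)
  have "is_functor ?G ?H ?f (snd (MMap ?F))"
    unfolding is_functor_def
  proof (intro conjI allI ballI fundamental_groupoid_is_category)
    show "?f a \<in> Ob ?H" if "a \<in> Ob ?G" for a
      using that cont by (auto simp: continuous_map_def)
    show "snd (MMap ?F) c \<in> Hom ?H (?f a) (?f b)" if c: "c \<in> Hom ?G a b" for a b c
    proof -
      obtain p where "pathin (Top A) p" "p 0 = a" "p 1 = b" "c = path_class (Top A) p"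
        using c unfolding fg_Hom_iff by blast
      then show ?thesis
        unfolding fg_Hom_iff by (intro exI[of _ "?f \<circ> p"]) (simp add: cls im)
    qed
    show "snd (MMap ?F) (Ide ?G a) = Ide ?H (?f a)" if "a \<in> Ob ?G" for a
      using that cls[of "\<lambda>t. a"] by (simp add: pathin_const_iff o_def)
    show "snd (MMap ?F) (Comp ?G d c) = Comp ?H (snd (MMap ?F) d) (snd (MMap ?F) c)"
      if c: "c \<in> Hom ?G x y" and d: "d \<in> Hom ?G y z" for x y z c d
    proof -
      obtain p where p: "pathin (Top A) p" "p 1 = y" "c = path_class (Top A) p"
        using c unfolding fg_Hom_iff by blast
      obtain q where q: "pathin (Top A) q" "q 0 = y" "d = path_class (Top A) q"
        using d unfolding fg_Hom_iff by blast
      show ?thesis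
        using p q by (simp add: fg_Comp cls im pathin_concat image_concat_path)
    qed
  qed
  moreover have "is_alg_hom T (arr_alg ?G) (arr_alg ?H) (snd (MMap ?F))"
    unfolding is_alg_hom_def arr_alg_def alg.simps
  proof (intro conjI allI ballI Pi_I)
    show "snd (MMap ?F) c \<in> Arr ?H" if c: "c \<in> Arr ?G" for c
    proof -
      obtain p where p: "pathin (Top A) p" "c = path_class (Top A) p" using c by auto
      show ?thesis unfolding p(2) cls[OF p(1)] by (rule path_class_Arr[OF im[OF p(1)]])
    qed
    fix n \<tau> x assume \<tau>: "\<tau> \<in> Hom T n 1" and x: "x \<in> tuples n (Arr ?G)"
    from x obtain \<beta> where \<beta>: "\<forall>i<n. pathin (Top A) (\<beta> i)"
      "\<forall>i<n. x i = path_class (Top A) (\<beta> i)" by (rule arr_tupleE)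
    have f\<beta>: "\<forall>i<n. pathin (Top B) (?f \<circ> \<beta> i)" using \<beta>(1) im by blast
    have "snd (MMap ?F) (ArrOp ?G \<tau> x) =
        path_class (Top B) (?f \<circ> (\<lambda>t. TOp A \<tau> (\<lambda>i\<in>{..<n}. \<beta> i t)))"
      unfolding fg_ArrOp[OF A \<tau> \<beta>] by (rule cls[OF pathin_op[OF A \<tau> \<beta>(1)]])
    also have "\<dots> = path_class (Top B) (\<lambda>t. TOp B \<tau> (\<lambda>i\<in>{..<n}. (?f \<circ> \<beta> i) t))"
    proof (rule path_class_cong[OF pathin_op[OF B \<tau> f\<beta>]])
      fix t :: real assume t: "t \<in> {0..1}"
      have "(\<lambda>i\<in>{..<n}. ?f ((\<lambda>i\<in>{..<n}. \<beta> i t) i)) = (\<lambda>i\<in>{..<n}. (?f \<circ> \<beta> i) t)"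
        by (rule restrict_ext) simp
      then show "(?f \<circ> (\<lambda>t. TOp A \<tau> (\<lambda>i\<in>{..<n}. \<beta> i t))) t =
          TOp B \<tau> (\<lambda>i\<in>{..<n}. (?f \<circ> \<beta> i) t)"
        using op[OF \<tau> pathin_tuple[OF \<beta>(1) t]] by simp
    qed
    also have "\<dots> = ArrOp ?H \<tau> (\<lambda>i\<in>{..<n}. snd (MMap ?F) (x i))"
      by (rule fg_ArrOp[OF B \<tau> f\<beta>, symmetric]) (simp add: \<beta> cls)
    finally show "snd (MMap ?F) (ArrOp ?G \<tau> x) = ArrOp ?H \<tau> (\<lambda>i\<in>{..<n}. snd (MMap ?F) (x i))" .
  qed
  moreover have "is_alg_hom T (ob_alg ?G) (ob_alg ?H) ?f"
    using hom by (simp add: ob_alg_def alg_of_def)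
  ultimately show ?thesis
    unfolding int_groupoid_cat_Hom_iff F(1-3)
    using fundamental_groupoid_is_int_groupoid[OF T A] fundamental_groupoid_is_int_groupoid[OF T B]
      ext F(4) by simp
qed

lemma fundamental_groupoid_map_simps:
  "MDom (fundamental_groupoid_map T f) = fundamental_groupoid T (MDom f)"
  "MCod (fundamental_groupoid_map T f) = fundamental_groupoid T (MCod f)"
  "fst (MMap (fundamental_groupoid_map T f)) = MMap f"
  by (simp_all add: fundamental_groupoid_map_def)

text \<open>
  Morphisms out of a fundamental groupoid are extensional, so it suffices to compare them on the
  classes of actual paths.
\<close>

lemma fundamental_groupoid_mor_eqI:
  assumes F: "F \<in> Hom (int_groupoid_cat T) (fundamental_groupoid T A) H"
    and K: "K \<in> Hom (int_groupoid_cat T) (fundamental_groupoid T A) H"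
    and ob: "fst (MMap F) = fst (MMap K)"
    and arr: "\<And>p. pathin (Top A) p \<Longrightarrow>
      snd (MMap F) (path_class (Top A) p) = snd (MMap K) (path_class (Top A) p)"
  shows "F = K"
proof -
  let ?R = "Arr (fundamental_groupoid T A)"
  have "snd (MMap F) \<in> extensional ?R" "snd (MMap K) \<in> extensional ?R"
    using F K unfolding int_groupoid_cat_Hom_iff by blast+
  then have "snd (MMap F) = snd (MMap K)"
    by (rule extensionalityI) (use arr in auto)
  with ob have "MMap F = MMap K" by (rule prod_eqI)
  with F K show ?thesis by (auto simp: int_groupoid_cat_Hom_iff intro: mor.equality)
qed

lemma fundamental_groupoid_map_Ide:
  assumes T: "algebraic_theory T" and A: "is_top_alg T A"
  shows "fundamental_groupoid_map T (Ide (top_alg_cat T) A) =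
         Ide (int_groupoid_cat T) (fundamental_groupoid T A)"
proof -
  let ?i = "Ide (top_alg_cat T) A"
  have i: "?i \<in> Hom (top_alg_cat T) A A"
    using A by (intro category_Ide[OF top_alg_cat_is_category]) simp
  show ?thesis
  proof (rule fundamental_groupoid_mor_eqI[OF fundamental_groupoid_map_Hom[OF T i]])
    show "Ide (int_groupoid_cat T) (fundamental_groupoid T A) \<in>
        Hom (int_groupoid_cat T) (fundamental_groupoid T A) (fundamental_groupoid T A)"
      using fundamental_groupoid_is_int_groupoid[OF T A]
      by (intro category_Ide[OF int_groupoid_cat_is_category]) simp
    show "fst (MMap (fundamental_groupoid_map T ?i)) =
        fst (MMap (Ide (int_groupoid_cat T) (fundamental_groupoid T A)))"
      by (simp add: fundamental_groupoid_map_simps)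
    fix p assume p: "pathin (Top A) p"
    have "p t \<in> topspace (Top A)" if "t \<in> {0..1}" for t
      using p that by (auto simp: pathin_def continuous_map_def)
    then have "path_class (Top A) (MMap ?i \<circ> p) = path_class (Top A) p"
      by (intro path_class_cong p) simp
    then show "snd (MMap (fundamental_groupoid_map T ?i)) (path_class (Top A) p) =
        snd (MMap (Ide (int_groupoid_cat T) (fundamental_groupoid T A))) (path_class (Top A) p)"
      unfolding fundamental_groupoid_map_class[OF i p]
      using path_class_Arr[OF p, of T] by (simp del: fundamental_groupoid_simps)
  qed
qed

lemma fundamental_groupoid_map_Comp:
  assumes T: "algebraic_theory T"
    and f: "f \<in> Hom (top_alg_cat T) A B" and g: "g \<in> Hom (top_alg_cat T) B C"
  shows "fundamental_groupoid_map T (Comp (top_alg_cat T) g f) =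
         Comp (int_groupoid_cat T) (fundamental_groupoid_map T g) (fundamental_groupoid_map T f)"
proof -
  let ?h = "Comp (top_alg_cat T) g f"
  let ?K = "Comp (int_groupoid_cat T) (fundamental_groupoid_map T g) (fundamental_groupoid_map T f)"
  have dom: "MDom f = A" and cont: "continuous_map (Top A) (Top B) (MMap f)"
    "continuous_map (Top B) (Top C) (MMap g)"
    using f g by (simp_all add: top_alg_cat_Hom_iff)
  have h: "?h \<in> Hom (top_alg_cat T) A C" by (rule category_Comp[OF top_alg_cat_is_category f g])
  show ?thesis
  proof (rule fundamental_groupoid_mor_eqI[OF fundamental_groupoid_map_Hom[OF T h]])
    show "?K \<in> Hom (int_groupoid_cat T) (fundamental_groupoid T A) (fundamental_groupoid T C)"
      by (rule category_Comp[OF int_groupoid_cat_is_category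
            fundamental_groupoid_map_Hom[OF T f] fundamental_groupoid_map_Hom[OF T g]])
    show "fst (MMap (fundamental_groupoid_map T ?h)) = fst (MMap ?K)"
      by (simp add: fundamental_groupoid_map_simps dom)
    fix p assume p: "pathin (Top A) p"
    note fp = pathin_image[OF p cont(1)]
    have "p t \<in> topspace (Top A)" if "t \<in> {0..1}" for t
      using p that by (auto simp: pathin_def continuous_map_def)
    then have "path_class (Top C) (MMap ?h \<circ> p) = path_class (Top C) (MMap g \<circ> (MMap f \<circ> p))"
      by (intro path_class_cong pathin_image[OF fp cont(2)]) (simp add: dom compose_eq)
    also have "\<dots> = snd (MMap ?K) (path_class (Top A) p)"
      using path_class_Arr[OF p, of T] fundamental_groupoid_map_class[OF f p]
        fundamental_groupoid_map_class[OF g fp]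
      by (simp add: fundamental_groupoid_map_simps dom compose_eq del: fundamental_groupoid_simps)
    finally show "snd (MMap (fundamental_groupoid_map T ?h)) (path_class (Top A) p) =
        snd (MMap ?K) (path_class (Top A) p)"
      unfolding fundamental_groupoid_map_class[OF h p] .
  qed
qed

theorem mainTheorem4:
  fixes T :: "'m lawvere"
  assumes "semi_abelian_theory T"
  shows "is_functor
           (top_alg_cat T :: (('m, 'a) top_alg, (('m, 'a) top_alg, 'a \<Rightarrow> 'a) mor) category)
           (int_groupoid_cat T)
           (fundamental_groupoid T)
           (fundamental_groupoid_map T)"
proof -
  have T: "algebraic_theory T" using assms by (simp add: semi_abelian_theory_def)
  show ?thesis
    unfolding is_functor_def
    by (intro conjI allI ballI top_alg_cat_is_category int_groupoid_cat_is_category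
          fundamental_groupoid_map_Hom[OF T] fundamental_groupoid_map_Comp[OF T]
          fundamental_groupoid_map_Ide[OF T])
       (simp_all add: fundamental_groupoid_is_int_groupoid[OF T])
qed

end
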